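(* Let $N\geq 1$ be an integer, let $V$ be the vertex set of the infinite $N$-ary tree and let $\Delta$ be its graph Laplacian on $l^2(V)$ (conductance $1$ on every edge). Let $\mu_c$ be the measure on $[-1,1]$ given by $d\mu_c=\frac{2}{\pi}\sqrt{1-x^2}\,dx$, and let $\mu_{c+p}$ be the measure on $[-1,1]$ given by $$d\mu_{c+p}=\frac{\frac{2}{\pi}\sqrt{1-x^2}}{1-2N^{-1/2}x+N^{-1}}\,dx.$$ Then: (i) If $N=1$, then $\Delta$ is unitarily equivalent to the operator of multiplication by $2-2x$ on $L^2(\mu_{c+p})$. (ii) If $N\geq 2$, then $\Delta$ is unitarily equivalent to the multiplication operator $$M_{c+p}\oplus\bigoplus_{n=1}^\infty M_c\quad\text{on}\quad L^2(\mu_{c+p})\oplus\bigoplus_{n=1}^\infty L^2(\mu_c),$$ where $M_{c+p}$ is multiplication by $N+1-2\sqrt{N}x$ on $L^2(\mu_{c+p})$ and $M_c$ is multiplication by $N+1-2\sqrt{N}x$ on $L^2(\mu_c)$.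
   Context: The infinite $N$-ary tree: $V$ is the set of all finite words over the alphabet $\{1,\dots,N\}$, including the empty word $\emptyset$; its edges are exactly the pairs $\{\omega,\omega i\}$ with $\omega\in V$, $i\in\{1,\dots,N\}$, where $\omega i$ is the word obtained by appending the letter $i$ to $\omega$. Write $x\sim y$ if $x,y$ are adjacent. The graph Laplacian is $(\Delta v)(x)=\sum_{y\sim x}(v(x)-v(y))$, defined on finitely supported functions and extended by closure; it is a bounded selfadjoint operator on $l^2(V)$. *)

theory Defs
  imports "HOL-Analysis.Analysis"
begin

definition tree_V :: "nat \<Rightarrow> nat list set" where
  "tree_V N = {w. set w \<subseteq> {1..N}}"

definition tree_adj :: "nat \<Rightarrow> nat list \<Rightarrow> nat list \<Rightarrow> bool" where
  "tree_adj N x y \<longleftrightarrow> x \<in> tree_V N \<and> y \<in> tree_V N \<and>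
     (\<exists>i\<in>{1..N}. y = x @ [i] \<or> x = y @ [i])"

definition l2V :: "nat \<Rightarrow> (nat list \<Rightarrow> complex) set" where
  "l2V N = {v. (\<forall>x. x \<notin> tree_V N \<longrightarrow> v x = 0) \<and>
               (\<lambda>x. (cmod (v x))\<^sup>2) summable_on tree_V N}"

definition l2V_normsq :: "nat \<Rightarrow> (nat list \<Rightarrow> complex) \<Rightarrow> real" where
  "l2V_normsq N v = (\<Sum>\<^sub>\<infinity>x\<in>tree_V N. (cmod (v x))\<^sup>2)"

text \<open>The graph Laplacian. Every vertex has finite degree, so the closure of
  the operator defined on finitely supported functions acts on l^2(V) by the
  same pointwise formula.\<close>
definition tree_laplacian :: "nat \<Rightarrow> (nat list \<Rightarrow> complex) \<Rightarrow> nat list \<Rightarrow> complex" where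
  "tree_laplacian N v x =
     (if x \<in> tree_V N then (\<Sum>y\<in>{y. tree_adj N x y}. (v x - v y)) else 0)"

definition mu_c :: "real measure" where
  "mu_c = density lborel
     (\<lambda>x. indicator {-1..1} x * ennreal (2 / pi * sqrt (1 - x\<^sup>2)))"

definition mu_cp :: "nat \<Rightarrow> real measure" where
  "mu_cp N = density lborel
     (\<lambda>x. indicator {-1..1} x *
        ennreal ((2 / pi * sqrt (1 - x\<^sup>2)) /
                 (1 - 2 * x / sqrt (real N) + 1 / real N)))"

definition L2 :: "real measure \<Rightarrow> (real \<Rightarrow> complex) set" where
  "L2 M = {f. f \<in> borel_measurable M \<and> integrable M (\<lambda>x. (cmod (f x))\<^sup>2)}"

definition L2_normsq :: "real measure \<Rightarrow> (real \<Rightarrow> complex) \<Rightarrow> real" where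
  "L2_normsq M f = (\<integral>x. (cmod (f x))\<^sup>2 \<partial>M)"

text \<open>The Hilbert direct sum of L^2(M n), n \<in> I (elements are families of
  representatives; components outside I are zero).\<close>
definition dsum_space :: "nat set \<Rightarrow> (nat \<Rightarrow> real measure) \<Rightarrow> (nat \<Rightarrow> real \<Rightarrow> complex) set" where
  "dsum_space I M = {F. (\<forall>n\<in>I. F n \<in> L2 (M n)) \<and> (\<forall>n. n \<notin> I \<longrightarrow> F n = (\<lambda>_. 0)) \<and>
      (\<lambda>n. L2_normsq (M n) (F n)) summable_on I}"

definition dsum_normsq :: "nat set \<Rightarrow> (nat \<Rightarrow> real measure) \<Rightarrow> (nat \<Rightarrow> real \<Rightarrow> complex) \<Rightarrow> real" where
  "dsum_normsq I M F = (\<Sum>\<^sub>\<infinity>n\<in>I. L2_normsq (M n) (F n))"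

definition dsum_eq :: "nat set \<Rightarrow> (nat \<Rightarrow> real measure) \<Rightarrow>
     (nat \<Rightarrow> real \<Rightarrow> complex) \<Rightarrow> (nat \<Rightarrow> real \<Rightarrow> complex) \<Rightarrow> bool" where
  "dsum_eq I M F G \<longleftrightarrow> (\<forall>n\<in>I. AE x in M n. F n x = G n x)"

definition lap_unitarily_equiv_mult ::
  "nat \<Rightarrow> nat set \<Rightarrow> (nat \<Rightarrow> real measure) \<Rightarrow> (real \<Rightarrow> real) \<Rightarrow> bool" where
  "lap_unitarily_equiv_mult N I M g \<longleftrightarrow>
    (\<exists>U :: (nat list \<Rightarrow> complex) \<Rightarrow> (nat \<Rightarrow> real \<Rightarrow> complex).
       (\<forall>v\<in>l2V N. U v \<in> dsum_space I M) \<and>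
       (\<forall>v\<in>l2V N. \<forall>w\<in>l2V N. \<forall>a b :: complex.
          dsum_eq I M (U (\<lambda>x. a * v x + b * w x)) (\<lambda>n t. a * U v n t + b * U w n t)) \<and>
       (\<forall>v\<in>l2V N. dsum_normsq I M (U v) = l2V_normsq N v) \<and>
       (\<forall>F\<in>dsum_space I M. \<exists>v\<in>l2V N. dsum_eq I M (U v) F) \<and>
       (\<forall>v\<in>l2V N. dsum_eq I M (U (tree_laplacian N v))
                      (\<lambda>n t. complex_of_real (g t) * U v n t)))"

end

theory Submission
  imports Defs
begin

text \<open>Let \<open>a = 1 / sqrt N\<close>. On the radial functions, in the basis of normalised level indicators, the
  Laplacian is \<open>N + 1 - 2 sqrt N J\<close>, where \<open>J\<close> is the Jacobi matrix with off-diagonal entries \<open>1/2\<close> and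
  diagonal \<open>a/2, 0, 0, ...\<close>. For a vertex \<open>u\<close> and a vector orthogonal to the constants on the
  children of \<open>u\<close>, extended radially to the subtrees below these children, it acts in the same way
  with diagonal \<open>0\<close>, because the value transported to \<open>u\<close> is a vanishing sum. These functions
  form an orthonormal basis of \<open>l\<^sup>2(V)\<close>, and for \<open>N \<ge> 2\<close> there are infinitely many chains of the second
  kind. The spectral measures of the two Jacobi matrices are \<open>mu_cp N\<close> and \<open>mu_c\<close>; density of the
  polynomials and completeness of \<open>L\<^sup>2\<close> make the expansion in orthonormal polynomials unitary.\<close>

section \<open>Expansion in orthonormal polynomials\<close>

text \<open>The entry \<open>a/2\<close> comes from the root, which has no parent: its degree is
  \<open>N = N + 1 - 2 * sqrt N * (a/2)\<close>, while every other vertex has degree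
  \<open>N + 1\<close>. Elements of \<open>L2 M\<close> are functions, equal only up to null sets,
  so both sides are compared through coefficients. Haar coefficients are finite sums, and Fourier
  coefficients determine a function almost everywhere. The intertwining relation then becomes the
  equality of two three-term recurrences, and recognising a spectral measure reduces to the
  integrals of \<open>jpoly a n\<close>. For \<open>mu_cp\<close> these follow from the ones for
  \<open>mu_c\<close> by clearing the denominator, once the total mass is known. The mass is the
  only integral that needs an arctangent.\<close>

text \<open>\<open>jpoly 0 n\<close> is the Chebyshev polynomial of the second kind \<open>U\<^sub>n\<close>, and
  \<open>jpoly a n = U\<^sub>n - a U\<^sub>n\<^sub>-\<^sub>1\<close>: the parameter perturbs only the first diagonal entry of the
  Jacobi matrix.\<close>
fun jpoly :: "real \<Rightarrow> nat \<Rightarrow> real \<Rightarrow> real" where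
  "jpoly a 0 x = 1"
| "jpoly a (Suc 0) x = 2 * x - a"
| "jpoly a (Suc (Suc n)) x = 2 * x * jpoly a (Suc n) x - jpoly a n x"

lemma continuous_on_jpoly [continuous_intros]: "continuous_on S (jpoly a n)"
proof (induction n rule: induct_nat_012)
  case (ge2 n)
  then show ?case by (auto intro!: continuous_intros)
qed (auto intro!: continuous_intros)

lemma jpoly_measurable [measurable]: "jpoly a n \<in> borel_measurable borel"
  by (intro borel_measurable_continuous_onI continuous_intros)

lemma times_jpoly_0: "x * jpoly a 0 x = jpoly a (Suc 0) x / 2 + a / 2 * jpoly a 0 x"
  by (simp add: field_simps)

lemma times_jpoly_Suc: "x * jpoly a (Suc n) x = jpoly a (Suc (Suc n)) x / 2 + jpoly a n x / 2"
  by (simp add: field_simps)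

text \<open>The last assumption fixes only the products with \<open>jpoly a 0\<close>, one scalar
  integral per degree. For \<open>n = 0\<close> it normalises the measure.\<close>

locale jacobi_measure =
  fixes M :: "real measure" and a :: real
  assumes finite_M: "finite_measure M"
    and sets_M [measurable_cong]: "sets M = sets borel"
    and support_M: "AE x in M. x \<in> {-1..1}"
    and integral_jpoly: "\<And>n. (\<integral>x. jpoly a n x \<partial>M) = (if n = 0 then 1 else 0)"
begin

sublocale finite_measure M
  by (rule finite_M)

lemma space_M: "space M = UNIV"
  using sets_eq_imp_space_eq[OF sets_M] by simp

lemma integrable_continuous_scaleR:
  fixes f :: "real \<Rightarrow> 'b::{banach, second_countable_topology}"
  assumes f: "integrable M f" and h: "continuous_on UNIV h"
  shows "integrable M (\<lambda>x. h x *\<^sub>R f x)"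
proof -
  have hm [measurable]: "h \<in> borel_measurable borel"
    by (rule borel_measurable_continuous_onI[OF h])
  have "compact (h ` {-1..1})"
    by (intro compact_continuous_image continuous_on_subset[OF h]) auto
  then obtain B where B: "\<And>x. x \<in> {-1..1} \<Longrightarrow> \<bar>h x\<bar> \<le> B"
    by (metis bounded_iff compact_imp_bounded imageI real_norm_def)
  show ?thesis
  proof (rule Bochner_Integration.integrable_bound)
    show "integrable M (\<lambda>x. B * norm (f x))" using f by auto
    show "(\<lambda>x. h x *\<^sub>R f x) \<in> borel_measurable M" using f by measurable
    show "AE x in M. norm (h x *\<^sub>R f x) \<le> norm (B * norm (f x))"
      using support_M
    proof eventually_elim
      case (elim x)
      then show ?case using B[OF elim]
        by (auto simp: abs_mult intro!: mult_right_mono)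
    qed
  qed
qed

lemma integrable_continuous:
  fixes h :: "real \<Rightarrow> real"
  assumes "continuous_on UNIV h" shows "integrable M h"
  using integrable_continuous_scaleR[OF integrable_const[of "1::real"] assms] by simp

lemma measure_M: "measure M UNIV = 1"
  using integral_jpoly[of 0] by (simp add: space_M)

lemma L2_integrable:
  assumes "f \<in> L2 M" shows "integrable M f"
proof (rule Bochner_Integration.integrable_bound)
  show "integrable M (\<lambda>x. 1 + (cmod (f x))\<^sup>2)"
    using assms by (auto simp: L2_def)
  show "AE x in M. norm (f x) \<le> norm (1 + (cmod (f x))\<^sup>2)"
  proof (rule AE_I2)
    fix x
    have "0 \<le> (cmod (f x) - 1)\<^sup>2" by simp
    then have "2 * cmod (f x) \<le> 1 + (cmod (f x))\<^sup>2" by (simp add: power2_diff)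
    then have "cmod (f x) \<le> 1 + (cmod (f x))\<^sup>2" using norm_ge_zero[of "f x"] by linarith
    then show "norm (f x) \<le> norm (1 + (cmod (f x))\<^sup>2)" by simp
  qed
qed (use assms in \<open>auto simp: L2_def\<close>)

lemma L2_lincomb:
  assumes f: "f \<in> L2 M" and g: "g \<in> L2 M"
  shows "(\<lambda>x. c * f x + d * g x) \<in> L2 M"
proof -
  have [measurable]: "f \<in> borel_measurable M" "g \<in> borel_measurable M"
    using f g by (auto simp: L2_def)
  have "integrable M (\<lambda>x. (cmod (c * f x + d * g x))\<^sup>2)"
  proof (rule Bochner_Integration.integrable_bound)
    show "integrable M (\<lambda>x. 2 * (cmod c)\<^sup>2 * (cmod (f x))\<^sup>2 + 2 * (cmod d)\<^sup>2 * (cmod (g x))\<^sup>2)"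
      using f g by (auto simp: L2_def)
    show "AE x in M. norm ((cmod (c * f x + d * g x))\<^sup>2) \<le>
       norm (2 * (cmod c)\<^sup>2 * (cmod (f x))\<^sup>2 + 2 * (cmod d)\<^sup>2 * (cmod (g x))\<^sup>2)"
    proof (rule AE_I2)
      fix x
      have "cmod (c * f x + d * g x) \<le> cmod c * cmod (f x) + cmod d * cmod (g x)"
        by (metis norm_mult norm_triangle_ineq)
      then have "(cmod (c * f x + d * g x))\<^sup>2 \<le> (cmod c * cmod (f x) + cmod d * cmod (g x))\<^sup>2"
        by (intro power_mono) auto
      also have "\<dots> \<le> 2 * (cmod c * cmod (f x))\<^sup>2 + 2 * (cmod d * cmod (g x))\<^sup>2"
        using sum_squares_ge_zero[of "cmod c * cmod (f x) - cmod d * cmod (g x)" 0]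
        by (simp add: power2_eq_square algebra_simps)
      finally show "norm ((cmod (c * f x + d * g x))\<^sup>2) \<le>
       norm (2 * (cmod c)\<^sup>2 * (cmod (f x))\<^sup>2 + 2 * (cmod d)\<^sup>2 * (cmod (g x))\<^sup>2)"
        by (simp add: power_mult_distrib)
    qed
  qed measurable
  then show ?thesis by (simp add: L2_def)
qed

lemma L2_continuous_mult:
  assumes f: "f \<in> L2 M" and h: "continuous_on UNIV h"
  shows "(\<lambda>x. complex_of_real (h x) * f x) \<in> L2 M"
proof -
  have hm [measurable]: "h \<in> borel_measurable borel"
    by (rule borel_measurable_continuous_onI[OF h])
  have [measurable]: "f \<in> borel_measurable M" using f by (auto simp: L2_def)
  have "integrable M (\<lambda>x. (h x)\<^sup>2 *\<^sub>R (cmod (f x))\<^sup>2)"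
    using f h by (intro integrable_continuous_scaleR) (auto simp: L2_def intro!: continuous_intros)
  then show ?thesis by (simp add: L2_def norm_mult power_mult_distrib)
qed

lemma jpoly_orthonormal:
  "(\<integral>x. jpoly a m x * jpoly a n x \<partial>M) = (if m = n then 1 else 0)"
proof -
  define G where "G m n = (\<integral>x. jpoly a m x * jpoly a n x \<partial>M)" for m n
  have int: "integrable M (\<lambda>x. jpoly a m x * jpoly a n x)" for m n
    by (intro integrable_continuous continuous_intros)
  have comm: "G m n = G n m" for m n
    by (simp add: G_def mult.commute)
  have G0: "G 0 n = (if n = 0 then 1 else 0)" for n
    unfolding G_def using integral_jpoly[of n] by simp
  have x0: "(\<integral>x. x * jpoly a 0 x * jpoly a n x \<partial>M) = G 1 n / 2 + a / 2 * G 0 n" for n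
    unfolding times_jpoly_0 G_def using int[of 1 n] int[of 0 n]
    by (simp add: distrib_right)
  have xS: "(\<integral>x. x * jpoly a (Suc m) x * jpoly a n x \<partial>M) = G (Suc (Suc m)) n / 2 + G m n / 2" for m n
    unfolding times_jpoly_Suc G_def using int[of "Suc (Suc m)" n] int[of m n]
    by (simp add: distrib_right del: jpoly.simps)
  have sym: "(\<integral>x. x * jpoly a m x * jpoly a n x \<partial>M) = (\<integral>x. x * jpoly a n x * jpoly a m x \<partial>M)" for m n
    by (simp add: mult_ac)
  \<comment> \<open>Symmetry of multiplication by \<open>x\<close> turns the recurrence into one for the Gram matrix,
    whose row \<open>0\<close> is known.\<close>
  have "\<forall>n. G m n = (if m = n then 1 else 0)"
  proof (induction m rule: induct_nat_012)
    case 0 show ?case using G0 by simp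
  next
    case 1
    show ?case
    proof
      fix n show "G (Suc 0) n = (if Suc 0 = n then 1 else 0)"
      proof (cases n)
        case 0 then show ?thesis using G0[of 1] comm[of 1 0] by simp
      next
        case (Suc k)
        have "G 1 n / 2 + a / 2 * G 0 n = G (Suc (Suc k)) 0 / 2 + G k 0 / 2"
          using x0[of n] xS[of k 0] sym[of 0 n] Suc by simp
        then show ?thesis using G0 comm Suc by auto
      qed
    qed
  next
    case (ge2 m)
    show ?case
    proof
      fix n show "G (Suc (Suc m)) n = (if Suc (Suc m) = n then 1 else 0)"
      proof (cases n)
        case 0 then show ?thesis using G0[of "Suc (Suc m)"] comm[of "Suc (Suc m)" 0] by simp
      next
        case (Suc k)
        have "G (Suc (Suc m)) n / 2 + G m n / 2 = G (Suc (Suc k)) (Suc m) / 2 + G k (Suc m) / 2"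
          using xS[of m n] xS[of k "Suc m"] sym[of "Suc m" n] Suc by simp
        then show ?thesis using ge2 comm[of _ "Suc m"] Suc by (auto split: if_splits)
      qed
    qed
  qed
  then show ?thesis by (simp add: G_def)
qed

section \<open>Fourier coefficients and multiplication by \<open>x\<close>\<close>

definition fourier :: "(real \<Rightarrow> complex) \<Rightarrow> nat \<Rightarrow> complex" where
  "fourier f k = (\<integral>x. jpoly a k x *\<^sub>R f x \<partial>M)"

lemma fourier_integrable: "integrable M f \<Longrightarrow> integrable M (\<lambda>x. jpoly a k x *\<^sub>R f x)"
  for f :: "real \<Rightarrow> complex"
  by (intro integrable_continuous_scaleR continuous_intros)

text \<open>With \<open>fourier_times_Suc\<close>: on coefficients, multiplication by
  \<open>x\<close> is the Jacobi matrix. This is the half of the intertwining relation that concerns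
  the measure.\<close>

lemma fourier_times_0:
  assumes f: "integrable M f"
  shows "fourier (\<lambda>x. complex_of_real x * f x) 0 = (1/2) *\<^sub>R fourier f 1 + (a / 2) *\<^sub>R fourier f 0"
proof -
  have "fourier (\<lambda>x. complex_of_real x * f x) 0
      = (\<integral>x. (1/2) *\<^sub>R (jpoly a 1 x *\<^sub>R f x) + (a/2) *\<^sub>R (jpoly a 0 x *\<^sub>R f x) \<partial>M)"
    unfolding fourier_def by (intro Bochner_Integration.integral_cong) (auto simp: scaleR_conv_of_real field_simps)
  also have "\<dots> = (1/2) *\<^sub>R fourier f 1 + (a / 2) *\<^sub>R fourier f 0"
    unfolding fourier_def
    by (simp only: Bochner_Integration.integral_add integrable_scaleR_right integral_scaleR_right
        fourier_integrable[OF f])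
  finally show ?thesis .
qed

lemma fourier_times_Suc:
  assumes f: "integrable M f"
  shows "fourier (\<lambda>x. complex_of_real x * f x) (Suc k)
    = (1/2) *\<^sub>R fourier f (Suc (Suc k)) + (1/2) *\<^sub>R fourier f k"
proof -
  have "fourier (\<lambda>x. complex_of_real x * f x) (Suc k)
      = (\<integral>x. (1/2) *\<^sub>R (jpoly a (Suc (Suc k)) x *\<^sub>R f x) + (1/2) *\<^sub>R (jpoly a k x *\<^sub>R f x) \<partial>M)"
    unfolding fourier_def by (intro Bochner_Integration.integral_cong) (auto simp: scaleR_conv_of_real field_simps)
  also have "\<dots> = (1/2) *\<^sub>R fourier f (Suc (Suc k)) + (1/2) *\<^sub>R fourier f k"
    unfolding fourier_def
    by (simp only: Bochner_Integration.integral_add integrable_scaleR_right integral_scaleR_right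
        fourier_integrable[OF f])
  finally show ?thesis .
qed

lemma fourier_lincomb:
  assumes f: "integrable M f" and g: "integrable M g"
  shows "fourier (\<lambda>x. c * f x + d * g x) k = c * fourier f k + d * fourier g k"
proof -
  have "fourier (\<lambda>x. c * f x + d * g x) k
      = (\<integral>x. c * (jpoly a k x *\<^sub>R f x) + d * (jpoly a k x *\<^sub>R g x) \<partial>M)"
    unfolding fourier_def by (intro Bochner_Integration.integral_cong) (auto simp: scaleR_conv_of_real field_simps)
  also have "\<dots> = c * fourier f k + d * fourier g k"
    unfolding fourier_def
    by (simp only: Bochner_Integration.integral_add integrable_mult_right integral_mult_right_zero
        fourier_integrable[OF f] fourier_integrable[OF g])
  finally show ?thesis .
qed

section \<open>Uniqueness of Fourier coefficients\<close>

lemma moments_zero: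
  assumes f: "integrable M f" and 0: "\<And>k. fourier f k = 0"
  shows "(\<integral>x. (x ^ n) *\<^sub>R f x \<partial>M) = 0"
proof -
  \<comment> \<open>By the recurrence, \<open>x * f\<close> inherits vanishing coefficients from
    \<open>f\<close>; the moment of order \<open>n\<close> is coefficient \<open>0\<close> of
    \<open>x^n * f\<close>, so no monomial has to be expanded in the \<open>jpoly\<close>.\<close>
  have "integrable M (\<lambda>x. complex_of_real (x ^ n) * f x) \<and>
      (\<forall>k. fourier (\<lambda>x. complex_of_real (x ^ n) * f x) k = 0)"
  proof (induction n)
    case 0 show ?case using f assms(2) by simp
  next
    case (Suc n)
    let ?f = "\<lambda>x. complex_of_real (x ^ n) * f x"
    have eq: "(\<lambda>x. complex_of_real (x ^ Suc n) * f x) = (\<lambda>x. complex_of_real x * ?f x)"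
      by (auto simp: fun_eq_iff)
    have i: "integrable M (\<lambda>x. complex_of_real x * ?f x)"
      using integrable_continuous_scaleR[of ?f "\<lambda>x. x"] Suc by (simp add: scaleR_conv_of_real)
    have "fourier (\<lambda>x. complex_of_real x * ?f x) k = 0" for k
      using Suc fourier_times_0[of ?f] fourier_times_Suc[of ?f] by (cases k) auto
    then show ?case using i unfolding eq by blast
  qed
  then have "fourier (\<lambda>x. complex_of_real (x ^ n) * f x) 0 = 0" by blast
  then show ?thesis by (simp add: fourier_def scaleR_conv_of_real)
qed

lemma integral_polynomial_zero:
  assumes f: "integrable M f" and 0: "\<And>k. fourier f k = 0" and q: "real_polynomial_function q"
  shows "(\<integral>x. q x *\<^sub>R f x \<partial>M) = 0"
proof -
  obtain c n where q: "q = (\<lambda>x. \<Sum>i\<le>n. c i * x ^ i)"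
    using q real_polynomial_function_iff_sum by auto
  have "integrable M (\<lambda>x. (x ^ i) *\<^sub>R f x)" for i
    by (intro integrable_continuous_scaleR f continuous_intros)
  then have "(\<integral>x. (\<Sum>i\<le>n. c i *\<^sub>R ((x ^ i) *\<^sub>R f x)) \<partial>M) = (\<Sum>i\<le>n. c i *\<^sub>R (\<integral>x. (x ^ i) *\<^sub>R f x \<partial>M))"
    by (simp only: Bochner_Integration.integral_sum integrable_scaleR_right integral_scaleR_right)
  then show ?thesis
    by (simp add: moments_zero[OF f 0] q scaleR_sum_left)
qed

lemma ramp_tendsto_indicator:
  "(\<lambda>n. min 1 (max 0 (real n * (x - c)))) \<longlonglongrightarrow> indicator {c<..} x"
proof (cases "x > c")
  case True
  obtain m where m: "real m * (x - c) > 1" using True reals_Archimedean3[of "x - c"] by auto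
  have "eventually (\<lambda>n. min 1 (max 0 (real n * (x - c))) = indicator {c<..} x) sequentially"
    using eventually_ge_at_top[of m]
  proof eventually_elim
    case (elim n)
    then have "real m * (x - c) \<le> real n * (x - c)" using True by (intro mult_right_mono) auto
    then have "1 \<le> real n * (x - c)" using m by linarith
    then show ?case using True by simp
  qed
  then show ?thesis by (rule tendsto_eventually)
next
  case False
  then have "real n * (x - c) \<le> 0" for n by (simp add: mult_nonneg_nonpos)
  then have "min 1 (max 0 (real n * (x - c))) = indicator {c<..} x" for n
    using False by (simp add: max_absorb1)
  then show ?thesis by simp
qed

text \<open>A polynomial within \<open>1/(n+1)\<close> of the ramp of slope \<open>n\<close> on
  \<open>[-1,1]\<close> joins Weierstrass approximation and the limit to the indicator in one
  sequence. It is bounded by \<open>2\<close> on the support, so dominated convergence applies with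
  majorant \<open>2 * norm (f x)\<close>.\<close>

lemma integral_Ioi_zero:
  assumes f: "integrable M f" and 0: "\<And>k. fourier f k = 0"
  shows "(\<integral>x. indicator {c<..} x *\<^sub>R f x \<partial>M) = 0"
proof -
  define r where "r n x = min 1 (max 0 (real n * (x - c)))" for n x
  have "\<exists>q. real_polynomial_function q \<and> (\<forall>x\<in>{-1..1}. \<bar>r n x - q x\<bar> < inverse (real (Suc n)))" for n
  proof -
    have "continuous_on {-1..1} (r n)"
      unfolding r_def by (intro continuous_intros)
    then show ?thesis
      by (rule Stone_Weierstrass_real_polynomial_function[OF compact_Icc, of _ _ _ "inverse (real (Suc n))"]) auto
  qed
  then obtain q where q: "\<And>n. real_polynomial_function (q n)"
      "\<And>n x. x \<in> {-1..1} \<Longrightarrow> \<bar>r n x - q n x\<bar> < inverse (real (Suc n))"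
    by metis
  have [measurable]: "f \<in> borel_measurable M" using f by auto
  have [measurable]: "q n \<in> borel_measurable borel" for n
    by (intro borel_measurable_continuous_onI continuous_on_polymonial_function) (use q real_polynomial_function_eq in blast)
  have "(\<lambda>n. \<integral>x. q n x *\<^sub>R f x \<partial>M) \<longlonglongrightarrow> (\<integral>x. indicator {c<..} x *\<^sub>R f x \<partial>M)"
  proof (rule integral_dominated_convergence)
    show "integrable M (\<lambda>x. 2 * norm (f x))" using f by auto
    show "AE x in M. (\<lambda>n. q n x *\<^sub>R f x) \<longlonglongrightarrow> indicator {c<..} x *\<^sub>R f x"
      using support_M
    proof eventually_elim
      case (elim x)
      have "(\<lambda>n. r n x - q n x) \<longlonglongrightarrow> 0"
        using q(2)[OF elim]
        by (intro Lim_null_comparison[OF _ LIMSEQ_inverse_real_of_nat]) (auto intro!: always_eventually less_imp_le)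
      moreover have "(\<lambda>n. r n x) \<longlonglongrightarrow> indicator {c<..} x"
        unfolding r_def by (rule ramp_tendsto_indicator)
      ultimately have "(\<lambda>n. r n x - (r n x - q n x)) \<longlonglongrightarrow> indicator {c<..} x - 0"
        by (intro tendsto_diff)
      then show ?case by (intro tendsto_scaleR tendsto_const) auto
    qed
    show "AE x in M. norm (q n x *\<^sub>R f x) \<le> 2 * norm (f x)" for n
      using support_M
    proof eventually_elim
      case (elim x)
      have "\<bar>r n x\<bar> \<le> 1" by (auto simp: r_def)
      moreover have "inverse (real (Suc n)) \<le> 1" by (simp add: inverse_le_1_iff)
      ultimately have "\<bar>q n x\<bar> \<le> 2" using q(2)[OF elim, of n] by linarith
      then show ?case by (auto intro: mult_right_mono)
    qed
  qed measurable
  moreover have "(\<integral>x. q n x *\<^sub>R f x \<partial>M) = 0" for n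
    by (rule integral_polynomial_zero[OF f 0 q(1)])
  ultimately show ?thesis by (simp add: LIMSEQ_const_iff)
qed

text \<open>The half-lines \<open>{c<..}\<close> are an intersection-stable generator of the Borel
  sets, so a pi-lambda argument carries the vanishing integrals over to all measurable sets.\<close>

lemma fourier_zero_imp_AE_zero:
  assumes f: "integrable M f" and 0: "\<And>k. fourier f k = 0"
  shows "AE x in M. f x = 0"
proof (rule density_zero[OF f])
  fix A assume "A \<in> sets M"
  then have A: "A \<in> sigma_sets UNIV (range (\<lambda>c::real. {c<..}))"
    using sets_M borel_Ioi[where 'a=real] by (metis sets_measure_of subset_UNIV Pow_UNIV)
  have sig: "B \<in> sets M" if "B \<in> sigma_sets UNIV (range (\<lambda>c::real. {c<..}))" for B
    using that sets_M borel_Ioi[where 'a=real] by (metis sets_measure_of subset_UNIV Pow_UNIV)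
  have si: "set_integrable M B f" if "B \<in> sets M" for B
    unfolding set_integrable_def using integrable_mult_indicator[OF that f] .
  \<comment> \<open>The complement step subtracts from the integral over the whole line, which is
    coefficient \<open>0\<close>.\<close>
  have univ: "(\<integral>x. f x \<partial>M) = 0" using assms(2)[of 0] by (simp add: fourier_def)
  have stable: "Int_stable (range (\<lambda>c::real. {c<..}))"
    by (auto simp: Int_stable_def lessThan_Int_lessThan)
  have sub: "range (\<lambda>c::real. {c<..}) \<subseteq> Pow UNIV" by simp
  show "set_lebesgue_integral M A f = 0"
    using stable sub A
  proof (induct rule: sigma_sets_induct_disjoint)
    case (basic B)
    then show ?case using integral_Ioi_zero[OF f 0] by (auto simp: set_lebesgue_integral_def)
  next
    case empty
    show ?case by (simp add: set_lebesgue_integral_def)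
  next
    case (compl B)
    have "(\<integral>x. indicator (UNIV - B) x *\<^sub>R f x \<partial>M) = (\<integral>x. f x - indicator B x *\<^sub>R f x \<partial>M)"
      by (intro Bochner_Integration.integral_cong) (auto simp: indicator_def)
    also have "\<dots> = 0"
      using f si[OF sig[OF compl(1)]] compl(2) univ
      by (simp add: set_integrable_def set_lebesgue_integral_def)
    finally show ?case by (simp add: set_lebesgue_integral_def)
  next
    case (union B)
    have B: "B i \<in> sets M" for i using union(2) sig by auto
    show ?case
      using union B
      by (subst lebesgue_integral_countable_add)
         (auto simp: disjoint_family_on_def intro!: si)
  qed
qed

lemma fourier_eq_imp_AE_eq:
  assumes f: "f \<in> L2 M" and g: "g \<in> L2 M" and eq: "\<And>k. fourier f k = fourier g k"
  shows "AE x in M. f x = g x"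
proof -
  have i: "integrable M f" "integrable M g" using f g L2_integrable by auto
  have "fourier (\<lambda>x. 1 * f x + (-1) * g x) k = 0" for k
    using fourier_lincomb[OF i, of 1 "-1" k] eq by simp
  then have "AE x in M. 1 * f x + (-1) * g x = 0"
    using i by (intro fourier_zero_imp_AE_zero) auto
  then show ?thesis by auto
qed

section \<open>Bessel, Riesz-Fischer and Parseval\<close>

definition jsum :: "(nat \<Rightarrow> complex) \<Rightarrow> nat set \<Rightarrow> real \<Rightarrow> complex" where
  "jsum c K x = (\<Sum>k\<in>K. jpoly a k x *\<^sub>R c k)"

lemma continuous_jsum: "continuous_on UNIV (jsum c K)"
  unfolding jsum_def by (intro continuous_intros)

lemma jsum_measurable [measurable]: "jsum c K \<in> borel_measurable borel"
  by (intro borel_measurable_continuous_onI continuous_jsum)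

lemma integrable_jsum_norm_sq: "integrable M (\<lambda>x. (cmod (jsum c K x))\<^sup>2)"
  by (intro integrable_continuous continuous_intros continuous_jsum)

lemma jsum_L2: "jsum c K \<in> L2 M"
  using integrable_jsum_norm_sq by (simp add: L2_def)

lemma integral_jsum_norm_sq:
  assumes K: "finite K"
  shows "(\<integral>x. (cmod (jsum c K x))\<^sup>2 \<partial>M) = (\<Sum>k\<in>K. (cmod (c k))\<^sup>2)"
proof -
  have i: "integrable M (\<lambda>x. jpoly a k x * jpoly a l x)" for k l
    by (intro integrable_continuous continuous_intros)
  \<comment> \<open>On complex numbers \<open>inner\<close> is the real part of the Hermitian
    product; this suffices for squared norms because the polynomials are real.\<close>
  have "(\<integral>x. (cmod (jsum c K x))\<^sup>2 \<partial>M)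
      = (\<integral>x. (\<Sum>k\<in>K. \<Sum>l\<in>K. (jpoly a k x * jpoly a l x) * inner (c k) (c l)) \<partial>M)"
    unfolding jsum_def power2_norm_eq_inner inner_sum_left
    by (simp only: inner_sum_right inner_scaleR_left inner_scaleR_right mult.assoc mult.left_commute)
  also have "\<dots> = (\<Sum>k\<in>K. \<Sum>l\<in>K. (\<integral>x. jpoly a k x * jpoly a l x \<partial>M) * inner (c k) (c l))"
    using i by (simp add: Bochner_Integration.integral_sum)
  also have "\<dots> = (\<Sum>k\<in>K. \<Sum>l\<in>K. if k = l then inner (c k) (c l) else 0)"
    by (intro sum.cong) (auto simp: jpoly_orthonormal)
  also have "\<dots> = (\<Sum>k\<in>K. (cmod (c k))\<^sup>2)"
    using K by (simp add: power2_norm_eq_inner)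
  finally show ?thesis .
qed

lemma fourier_jsum:
  assumes K: "finite K"
  shows "fourier (jsum c K) k = (if k \<in> K then c k else 0)"
proof -
  have i: "integrable M (\<lambda>x. jpoly a k x * jpoly a l x)" for k l
    by (intro integrable_continuous continuous_intros)
  have "fourier (jsum c K) k = (\<integral>x. (\<Sum>l\<in>K. (jpoly a k x * jpoly a l x) *\<^sub>R c l) \<partial>M)"
    unfolding fourier_def jsum_def by (simp add: scaleR_sum_right)
  also have "\<dots> = (\<Sum>l\<in>K. (\<integral>x. jpoly a k x * jpoly a l x \<partial>M) *\<^sub>R c l)"
    using i by (simp add: Bochner_Integration.integral_sum)
  also have "\<dots> = (\<Sum>l\<in>K. if k = l then c l else 0)"
    by (intro sum.cong) (auto simp: jpoly_orthonormal)
  finally show ?thesis using K by simp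
qed

text \<open>Expand the squared norm of \<open>f - jsum (fourier f) K\<close>, which is
  nonnegative.\<close>

lemma bessel:
  assumes f: "f \<in> L2 M" and K: "finite K"
  shows "(\<Sum>k\<in>K. (cmod (fourier f k))\<^sup>2) \<le> L2_normsq M f"
proof -
  let ?c = "fourier f"
  have fi: "integrable M f" by (rule L2_integrable[OF f])
  have ii: "integrable M (\<lambda>x. jpoly a k x * inner (f x) (?c k))" for k
    using integrable_inner_left[of "?c k", OF fourier_integrable[OF fi, of k]] by simp
  have cross: "(\<integral>x. inner (f x) (jsum ?c K x) \<partial>M) = (\<Sum>k\<in>K. (cmod (?c k))\<^sup>2)"
  proof -
    have "(\<integral>x. inner (f x) (jsum ?c K x) \<partial>M) = (\<integral>x. (\<Sum>k\<in>K. jpoly a k x * inner (f x) (?c k)) \<partial>M)"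
      by (simp add: jsum_def inner_sum_right)
    also have "\<dots> = (\<Sum>k\<in>K. \<integral>x. inner (jpoly a k x *\<^sub>R f x) (?c k) \<partial>M)"
      using ii by (simp add: Bochner_Integration.integral_sum)
    also have "\<dots> = (\<Sum>k\<in>K. inner (\<integral>x. jpoly a k x *\<^sub>R f x \<partial>M) (?c k))"
      using fourier_integrable[OF fi] by (intro sum.cong refl integral_inner_left) auto
    finally show ?thesis by (simp add: power2_norm_eq_inner fourier_def)
  qed
  have ci: "integrable M (\<lambda>x. inner (f x) (jsum ?c K x))"
    using ii by (simp add: jsum_def inner_sum_right)
  have f2: "integrable M (\<lambda>x. (cmod (f x))\<^sup>2)" using f by (simp add: L2_def)
  have sq: "(cmod (u - v))\<^sup>2 = (cmod u)\<^sup>2 - 2 * inner u v + (cmod v)\<^sup>2" for u v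
    unfolding power2_norm_eq_inner by (simp add: inner_diff_left inner_diff_right inner_commute[of v u])
  have "0 \<le> (\<integral>x. (cmod (f x - jsum ?c K x))\<^sup>2 \<partial>M)" by simp
  also have "\<dots> = (\<integral>x. (cmod (f x))\<^sup>2 - 2 * inner (f x) (jsum ?c K x) + (cmod (jsum ?c K x))\<^sup>2 \<partial>M)"
    by (simp only: sq)
  also have "\<dots> = L2_normsq M f - (\<Sum>k\<in>K. (cmod (?c k))\<^sup>2)"
    using f2 ci integrable_jsum_norm_sq[of ?c K] cross integral_jsum_norm_sq[OF K, of ?c]
    by (simp add: L2_normsq_def)
  finally show ?thesis by simp
qed

text \<open>A subsequence of partial sums with rapidly shrinking tails converges almost everywhere,
  and dominated convergence transfers the coefficients to its limit. Fatou's lemma gives only an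
  inequality for the norm, which \<open>parseval\<close> sharpens.\<close>

lemma riesz_fischer:
  assumes c: "summable (\<lambda>k. (cmod (c k))\<^sup>2)"
  shows "\<exists>f\<in>L2 M. (\<forall>k. fourier f k = c k) \<and> L2_normsq M f \<le> (\<Sum>k. (cmod (c k))\<^sup>2)"
proof -
  define r where "r m = (\<Sum>k. (cmod (c (k + m)))\<^sup>2)" for m
  have r0: "r \<longlonglongrightarrow> 0"
    unfolding r_def by (rule suminf_exist_split2[OF c])
  \<comment> \<open>Tails of the sum of squares below \<open>4^-j\<close> bound the blocks between
    consecutive partial sums by \<open>2^-j\<close> in the \<open>L^1\<close> norm, a summable
    bound.\<close>
  have "\<exists>m. \<forall>j. r (m j) \<le> (1/4) ^ j \<and> m j < m (Suc j)"
  proof (rule dependent_nat_choice)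
    show "\<exists>x. r x \<le> (1/4) ^ 0"
      using order_tendstoD(2)[OF r0, of 1] by (auto simp: eventually_sequentially intro: less_imp_le)
    fix x n
    have "eventually (\<lambda>m. r m < (1/4) ^ Suc n \<and> m > x) sequentially"
      by (intro eventually_conj order_tendstoD(2)[OF r0] eventually_gt_at_top) auto
    then show "\<exists>y. r y \<le> (1/4) ^ Suc n \<and> x < y"
      by (auto simp: eventually_sequentially intro: less_imp_le)
  qed
  then obtain m where m: "\<And>j. r (m j) \<le> (1/4) ^ j" "\<And>j. m j < m (Suc j)" by blast
  have sm: "strict_mono m" using m(2) by (simp add: strict_mono_Suc_iff)
  define S where "S j = jsum c {..<m j}" for j
  define D where "D j = jsum c {m j..<m (Suc j)}" for j
  have SD: "S j x = S 0 x + (\<Sum>i<j. D i x)" for j x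
  proof (induction j)
    case (Suc j)
    have "S (Suc j) x = S j x + D j x"
      unfolding S_def D_def jsum_def
      using m(2)[of j] by (subst sum.union_disjoint[symmetric]) (auto intro!: sum.cong)
    then show ?case using Suc by simp
  qed simp
  have [measurable]: "S j \<in> borel_measurable borel" "D j \<in> borel_measurable borel" for j
    by (simp_all add: S_def D_def)
  have Di: "integrable M (D j)" for j
    unfolding D_def by (rule L2_integrable[OF jsum_L2])
  have Si: "integrable M (S j)" for j
    unfolding S_def by (rule L2_integrable[OF jsum_L2])
  have D2: "(\<integral>x. (cmod (D j x))\<^sup>2 \<partial>M) \<le> (1/4) ^ j" for j
  proof -
    have "(\<integral>x. (cmod (D j x))\<^sup>2 \<partial>M) = (\<Sum>k\<in>{m j..<m (Suc j)}. (cmod (c k))\<^sup>2)"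
      unfolding D_def by (simp add: integral_jsum_norm_sq)
    also have "\<dots> = (\<Sum>k<m (Suc j) - m j. (cmod (c (k + m j)))\<^sup>2)"
      by (rule sum.reindex_bij_witness[of _ "\<lambda>k. k + m j" "\<lambda>k. k - m j"]) auto
    also have "\<dots> \<le> r (m j)"
      unfolding r_def by (intro sum_le_suminf summable_ignore_initial_segment[OF c, of "m j"]) auto
    finally show ?thesis using m(1)[of j] by simp
  qed
  have D1: "(\<integral>x. norm (D j x) \<partial>M) \<le> (1/2) ^ j" for j
  proof -
    have sq: "integrable M (\<lambda>x. (cmod (D j x))\<^sup>2)"
      unfolding D_def by (rule integrable_jsum_norm_sq)
    \<comment> \<open>AM-GM with weight \<open>2^j\<close> replaces Cauchy-Schwarz.\<close>
    have "(\<integral>x. norm (D j x) \<partial>M) \<le> (\<integral>x. 2^j / 2 * (cmod (D j x))\<^sup>2 + (1/2)^j / 2 \<partial>M)"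
    proof (rule integral_mono)
      fix x
      define u :: real where "u = 2 ^ j"
      have u: "u > 0" "(1/2) ^ j = 1 / u" by (simp_all add: u_def power_one_over)
      have "0 \<le> (u * cmod (D j x) - 1)\<^sup>2" by simp
      then have "2 * (u * cmod (D j x)) \<le> u * (u * (cmod (D j x))\<^sup>2) + 1"
        by (simp add: power2_eq_square algebra_simps)
      then have "cmod (D j x) \<le> u / 2 * (cmod (D j x))\<^sup>2 + 1 / u / 2"
        using u(1) by (simp add: field_simps)
      then show "norm (D j x) \<le> 2^j / 2 * (cmod (D j x))\<^sup>2 + (1/2)^j / 2"
        unfolding u(2) by (simp only: u_def)
    qed (use Di sq in auto)
    also have "\<dots> = 2^j / 2 * (\<integral>x. (cmod (D j x))\<^sup>2 \<partial>M) + (1/2)^j / 2"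
      using sq measure_M by (simp add: space_M)
    also have "\<dots> \<le> 2^j / 2 * (1/4)^j + (1/2)^j / 2"
      using D2[of j] by (intro add_right_mono mult_left_mono) auto
    also have "\<dots> = (1/2)^j"
    proof -
      have "(2::real)^j * (1/4)^j = (1/2)^j" by (simp add: power_mult_distrib[symmetric])
      then show ?thesis by (simp add: field_simps)
    qed
    finally show ?thesis .
  qed
  have sumD: "summable (\<lambda>j. \<integral>x. norm (D j x) \<partial>M)"
    by (rule summable_comparison_test'[OF summable_geometric[of "1/2"], of 0]) (auto simp: D1)
  \<comment> \<open>Monotone convergence: the series of norms has finite integral, hence is finite
    almost everywhere.\<close>
  have AEs: "AE x in M. summable (\<lambda>j. norm (D j x))"
  proof -
    have "(\<integral>\<^sup>+x. (\<Sum>j. ennreal (norm (D j x))) \<partial>M) = (\<Sum>j. \<integral>\<^sup>+x. ennreal (norm (D j x)) \<partial>M)"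
      by (intro nn_integral_suminf) auto
    also have "\<dots> = (\<Sum>j. ennreal (\<integral>x. norm (D j x) \<partial>M))"
      using Di by (simp add: nn_integral_eq_integral)
    also have "\<dots> = ennreal (\<Sum>j. \<integral>x. norm (D j x) \<partial>M)"
      using sumD by (intro suminf_ennreal2) auto
    finally have "AE x in M. (\<Sum>j. ennreal (norm (D j x))) \<noteq> \<infinity>"
      by (intro nn_integral_PInf_AE) auto
    then show ?thesis
      by eventually_elim (rule summable_suminf_not_top, simp_all)
  qed
  define f where "f x = S 0 x + (\<Sum>j. D j x)" for x
  have fm [measurable]: "f \<in> borel_measurable borel" unfolding f_def[abs_def] by measurable
  have lim: "AE x in M. (\<lambda>j. S j x) \<longlonglongrightarrow> f x"
    using AEs
  proof eventually_elim
    case (elim x)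
    then have "(\<lambda>j. \<Sum>i<j. D i x) \<longlonglongrightarrow> (\<Sum>j. D j x)"
      by (rule summable_LIMSEQ[OF summable_norm_cancel])
    then have "(\<lambda>j. S 0 x + (\<Sum>i<j. D i x)) \<longlonglongrightarrow> f x"
      unfolding f_def by (rule tendsto_add[OF tendsto_const])
    then show ?case by (simp only: SD[symmetric])
  qed
  \<comment> \<open>A single integrable majorant for all the partial sums
    \<open>S j\<close>.\<close>
  define w where "w x = norm (S 0 x) + (\<Sum>j. norm (D j x))" for x
  have wi: "integrable M w"
    unfolding w_def using Si Di AEs sumD
    by (intro Bochner_Integration.integrable_add integrable_suminf) auto
  have Sw: "AE x in M. norm (S j x) \<le> w x" for j
    using AEs
  proof eventually_elim
    case (elim x)
    have "norm (S j x) \<le> norm (S 0 x) + norm (\<Sum>i<j. D i x)"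
      unfolding SD[of j x] by (rule norm_triangle_ineq)
    also have "norm (\<Sum>i<j. D i x) \<le> (\<Sum>i<j. norm (D i x))" by (rule norm_sum)
    also have "\<dots> \<le> (\<Sum>j. norm (D j x))" using elim by (intro sum_le_suminf) auto
    finally show ?case by (simp add: w_def)
  qed
  have haar_coef: "fourier f k = c k" for k
  proof -
    have lim_f: "(\<lambda>j. fourier (S j) k) \<longlonglongrightarrow> fourier f k"
      unfolding fourier_def
    proof (rule integral_dominated_convergence)
      show "integrable M (\<lambda>x. \<bar>jpoly a k x\<bar> *\<^sub>R w x)"
        by (intro integrable_continuous_scaleR wi continuous_intros)
      show "AE x in M. (\<lambda>j. jpoly a k x *\<^sub>R S j x) \<longlonglongrightarrow> jpoly a k x *\<^sub>R f x"
        using lim by eventually_elim (intro tendsto_intros)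
      show "AE x in M. norm (jpoly a k x *\<^sub>R S j x) \<le> \<bar>jpoly a k x\<bar> *\<^sub>R w x" for j
        using Sw[of j] by eventually_elim (auto intro: mult_left_mono)
    qed measurable
    have "eventually (\<lambda>j. fourier (S j) k = c k) sequentially"
      using eventually_gt_at_top[of k]
    proof eventually_elim
      case (elim j)
      then have "k < m j" using seq_suble[OF sm, of j] by simp
      then show ?case by (simp add: S_def fourier_jsum)
    qed
    then show ?thesis
      by (rule LIMSEQ_unique[OF lim_f tendsto_eventually])
  qed
  define B where "B = (\<Sum>k. (cmod (c k))\<^sup>2)"
  have B0: "0 \<le> B" unfolding B_def using c by (intro suminf_nonneg) auto
  have nn: "(\<integral>\<^sup>+x. ennreal ((cmod (f x))\<^sup>2) \<partial>M) \<le> ennreal B"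
  proof -
    have "AE x in M. ennreal ((cmod (f x))\<^sup>2) = liminf (\<lambda>j. ennreal ((cmod (S j x))\<^sup>2))"
      using lim
    proof eventually_elim
      case (elim x)
      then have "(\<lambda>j. ennreal ((cmod (S j x))\<^sup>2)) \<longlonglongrightarrow> ennreal ((cmod (f x))\<^sup>2)"
        by (intro tendsto_intros)
      then show ?case by (rule lim_imp_Liminf[OF sequentially_bot, symmetric])
    qed
    then have "(\<integral>\<^sup>+x. ennreal ((cmod (f x))\<^sup>2) \<partial>M) = (\<integral>\<^sup>+x. liminf (\<lambda>j. ennreal ((cmod (S j x))\<^sup>2)) \<partial>M)"
      by (rule nn_integral_cong_AE)
    also have "\<dots> \<le> liminf (\<lambda>j. \<integral>\<^sup>+x. ennreal ((cmod (S j x))\<^sup>2) \<partial>M)"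
      by (intro nn_integral_liminf) measurable
    also have "\<dots> \<le> liminf (\<lambda>j::nat. ennreal B)"
    proof (intro Liminf_mono always_eventually allI)
      fix j
      have "(\<integral>\<^sup>+x. ennreal ((cmod (S j x))\<^sup>2) \<partial>M) = ennreal (\<Sum>k<m j. (cmod (c k))\<^sup>2)"
        unfolding S_def using integrable_jsum_norm_sq[of c "{..<m j}"]
        by (simp add: nn_integral_eq_integral integral_jsum_norm_sq)
      also have "\<dots> \<le> ennreal B"
        unfolding B_def using c by (intro ennreal_leI sum_le_suminf) auto
      finally show "(\<integral>\<^sup>+x. ennreal ((cmod (S j x))\<^sup>2) \<partial>M) \<le> ennreal B" .
    qed
    also have "\<dots> = ennreal B" by (simp add: Liminf_const)
    finally show ?thesis .
  qed
  have f2: "integrable M (\<lambda>x. (cmod (f x))\<^sup>2)"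
    using nn by (intro integrableI_bounded) (auto intro: le_less_trans)
  have "L2_normsq M f \<le> B"
    using nn B0 nn_integral_eq_integral[OF f2] by (simp add: L2_normsq_def)
  moreover have "f \<in> L2 M" using f2 by (simp add: L2_def)
  ultimately show ?thesis using haar_coef unfolding B_def by blast
qed

text \<open>Riesz-Fischer applied to the coefficients of \<open>f\<close> returns a function that
  agrees with \<open>f\<close> almost everywhere by uniqueness; its norm bound is the reverse of
  Bessel's inequality.\<close>

lemma parseval:
  assumes f: "f \<in> L2 M"
  shows "((\<lambda>k. (cmod (fourier f k))\<^sup>2) has_sum L2_normsq M f) UNIV"
proof -
  let ?c = "fourier f"
  have s: "summable (\<lambda>k. (cmod (?c k))\<^sup>2)"
    using bessel[OF f] by (intro summableI_nonneg_bounded[of _ "L2_normsq M f"]) auto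
  obtain g where g: "g \<in> L2 M" "\<And>k. fourier g k = ?c k" "L2_normsq M g \<le> (\<Sum>k. (cmod (?c k))\<^sup>2)"
    using riesz_fischer[OF s] by blast
  have "AE x in M. f x = g x" using fourier_eq_imp_AE_eq[OF f g(1)] g(2) by simp
  then have "L2_normsq M f = L2_normsq M g"
    unfolding L2_normsq_def using f g(1) by (intro integral_cong_AE) (auto simp: L2_def)
  moreover have "(\<Sum>k. (cmod (?c k))\<^sup>2) \<le> L2_normsq M f"
    using bessel[OF f] s by (intro suminf_le_const) auto
  ultimately have "(\<Sum>k. (cmod (?c k))\<^sup>2) = L2_normsq M f" using g(3) by simp
  then show ?thesis
    using s by (intro sums_nonneg_imp_has_sum) (auto simp: sums_iff)
qed

end

section \<open>The spectral measures\<close>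

text \<open>For \<open>x = cos t\<close> this is \<open>U_n(cos t) * sin t = sin((n+1) t)\<close>.
  Keeping the factor on the left avoids division by zero at the endpoints and produces the density
  of \<open>mu_c\<close>.\<close>

lemma jpoly_zero_sqrt:
  assumes "-1 \<le> x" "x \<le> 1"
  shows "jpoly 0 n x * sqrt (1 - x\<^sup>2) = sin (real (Suc n) * arccos x)"
proof (induction n rule: induct_nat_012)
  case 0
  then show ?case using assms by (simp add: sin_arccos)
next
  case 1
  then show ?case using assms sin_double[of "arccos x"] by (simp add: sin_arccos)
next
  case (ge2 n)
  let ?t = "arccos x"
  have c: "cos ?t = x" using assms by simp
  have "sin (real (Suc (Suc (Suc n))) * ?t) + sin (real (Suc n) * ?t)
      = sin (real (Suc (Suc n)) * ?t + ?t) + sin (real (Suc (Suc n)) * ?t - ?t)"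
    by (simp add: algebra_simps)
  also have "\<dots> = 2 * x * sin (real (Suc (Suc n)) * ?t)"
    unfolding sin_add sin_diff c by simp
  finally show ?case
    using ge2 by (simp add: algebra_simps del: of_nat_Suc)
qed

lemma jpoly_eq_jpoly_zero: "jpoly a (Suc n) x = jpoly 0 (Suc n) x - a * jpoly 0 n x"
proof (induction n rule: induct_nat_012)
  case (ge2 n)
  have "jpoly a (Suc (Suc (Suc n))) x = 2 * x * jpoly a (Suc (Suc n)) x - jpoly a (Suc n) x"
    by simp
  then show ?case unfolding ge2 by (simp add: algebra_simps)
qed (auto simp: algebra_simps)

lemma has_integral_sin_arccos:
  "((\<lambda>x. sin (real (Suc n) * arccos x)) has_integral (if n = 0 then pi / 2 else 0)) {-1..1}"
proof -
  \<comment> \<open>With \<open>x = cos t\<close> the integrand becomes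
    \<open>- sin((n+1) t) * sin t\<close>, half of \<open>cos((n+2) t) - cos(n t)\<close>. For
    \<open>n = 0\<close> the primitive \<open>sin(n t) / n\<close> of the second cosine degenerates
    to \<open>t\<close>.\<close>
  define F where "F x = sin (real (n + 2) * arccos x) / (2 * real (n + 2))
      - (if n = 0 then arccos x / 2 else sin (real n * arccos x) / (2 * real n))" for x
  have "((\<lambda>x. sin (real (Suc n) * arccos x)) has_integral (F 1 - F (-1))) {-1..1}"
  \<comment> \<open>\<open>arccos\<close> is not differentiable at the endpoints, where this version
    asks only for continuity.\<close>
  proof (rule fundamental_theorem_of_calculus_interior)
    show "continuous_on {-1..1} F"
      unfolding F_def by (cases "n = 0") (auto intro!: continuous_intros)
    fix x :: real assume x: "x \<in> {-1<..<1}"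
    define t where "t = arccos x"
    define s where "s = sqrt (1 - x\<^sup>2)"
    have st: "sin t = s" using x by (simp add: t_def s_def sin_arccos)
    have s: "s > 0" using x by (auto simp: s_def abs_square_less_1 abs_less_iff)
    have d: "(arccos has_real_derivative inverse (- s)) (at x)"
      unfolding s_def using x by (intro DERIV_arccos) auto
    have d2: "((\<lambda>x. sin (k * arccos x) / (2 * k)) has_real_derivative (- cos (k * t) / (2 * s))) (at x)"
      if "k \<noteq> 0" for k
      using DERIV_cdivide[OF DERIV_chain2[OF DERIV_sin DERIV_cmult[OF d, of k]], of "2 * k"] s that
      by (simp add: t_def field_simps)
    have key: "cos (real n * t) - cos (real (n + 2) * t) = 2 * sin (real (Suc n) * t) * s"
    proof -
      have "cos (real n * t) - cos (real (n + 2) * t)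
          = cos (real (Suc n) * t - t) - cos (real (Suc n) * t + t)"
        by (simp add: algebra_simps)
      then show ?thesis by (simp add: cos_add cos_diff st)
    qed
    have "(F has_real_derivative sin (real (Suc n) * t)) (at x)"
    proof (cases "n = 0")
      case True
      have "((\<lambda>x. sin (real (n + 2) * arccos x) / (2 * real (n + 2)) - arccos x / 2)
          has_real_derivative (- cos (real (n + 2) * t) / (2 * s) - inverse (- s) / 2)) (at x)"
        by (intro DERIV_diff d2 DERIV_cdivide d) simp
      moreover have "- cos (real (n + 2) * t) / (2 * s) - inverse (- s) / 2 = sin (real (Suc n) * t)"
        using key s True by (simp add: field_simps)
      ultimately show ?thesis using True unfolding F_def by simp
    next
      case False
      have "((\<lambda>x. sin (real (n + 2) * arccos x) / (2 * real (n + 2)) - sin (real n * arccos x) / (2 * real n))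
          has_real_derivative (- cos (real (n + 2) * t) / (2 * s) - - cos (real n * t) / (2 * s))) (at x)"
        by (intro DERIV_diff d2) (use False in auto)
      moreover have "- cos (real (n + 2) * t) / (2 * s) - - cos (real n * t) / (2 * s) = sin (real (Suc n) * t)"
        using key s by (simp add: field_simps)
      ultimately show ?thesis using False unfolding F_def by simp
    qed
    then show "(F has_vector_derivative sin (real (Suc n) * arccos x)) (at x)"
      by (simp add: t_def has_real_derivative_iff_has_vector_derivative)
  qed simp
  moreover have "F 1 = 0" by (simp add: F_def)
  moreover have "F (-1) = - (if n = 0 then pi / 2 else 0)"
    using sin_npi[of "n + 2"] sin_npi[of n] by (simp add: F_def)
  ultimately show ?thesis by simp
qed

lemma has_integral_sqrt_over_quadratic:
  assumes a: "0 < a" "a \<le> (1::real)"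
  shows "((\<lambda>x. sqrt (1 - x\<^sup>2) / (1 - 2 * a * x + a\<^sup>2)) has_integral (pi / 2)) {-1..1}"
proof -
  \<comment> \<open>With \<open>x = cos t\<close> the arctangent is \<open>\<Sum>k\<ge>1. a^k sin (k t) / k\<close>. For \<open>a = 1\<close> its coefficient
    vanishes, so the junk value of the quotient at \<open>x = 1\<close> does no harm.\<close>
  define F where "F x = (1 - a\<^sup>2) / (2 * a\<^sup>2) * arctan (a * sqrt (1 - x\<^sup>2) / (1 - a * x))
      - arccos x / 2 - sqrt (1 - x\<^sup>2) / (2 * a)" for x
  have pos: "1 - a * x > 0" if "x < 1" "-1 \<le> x" for x
  proof -
    have "a * x < 1"
    proof (cases "x \<le> 0")
      case True then show ?thesis using a by (meson le_less_trans less_eq_real_def mult_nonneg_nonpos zero_less_one)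
    next
      case False
      then have "a * x \<le> 1 * x" using a by (intro mult_right_mono) auto
      then show ?thesis using that by simp
    qed
    then show ?thesis by simp
  qed
  have "((\<lambda>x. sqrt (1 - x\<^sup>2) / (1 - 2 * a * x + a\<^sup>2)) has_integral (F 1 - F (-1))) {-1..1}"
  proof (rule fundamental_theorem_of_calculus_interior)
    show "continuous_on {-1..1} F"
    proof (cases "a = 1")
      case True
      then show ?thesis unfolding F_def by (auto intro!: continuous_intros)
    next
      case False
      have "1 - a * x \<noteq> 0" if "x \<in> {-1..1}" for x
        using pos[of x] that False a by (cases "x = 1") auto
      then show ?thesis unfolding F_def using a
        by (auto intro!: continuous_intros)
    qed
    fix x :: real assume x: "x \<in> {-1<..<1}"
    define s where "s = sqrt (1 - x\<^sup>2)"
    define q where "q = 1 - a * x"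
    define w where "w = 1 - 2 * a * x + a\<^sup>2"
    have x2: "1 - x\<^sup>2 > 0" using x by (auto simp: abs_square_less_1 abs_less_iff)
    have s: "s > 0" using x2 by (simp add: s_def)
    have s2: "s\<^sup>2 = 1 - x\<^sup>2" using x2 by (simp add: s_def)
    have q: "q > 0" unfolding q_def using pos x by auto
    \<comment> \<open>\<open>w\<close> is the squared modulus of \<open>1 - a * exp(i t)\<close>,
      with real part \<open>q\<close> and imaginary part \<open>- a * s\<close>; the arctangent in
      \<open>F\<close> is minus its argument.\<close>
    have wq: "w = q\<^sup>2 + a\<^sup>2 * s\<^sup>2"
      unfolding w_def q_def s2 by (simp add: power2_eq_square algebra_simps)
    have w: "w > 0" unfolding wq using q by (simp add: add_pos_nonneg)
    have d1: "(arccos has_real_derivative inverse (- s)) (at x)"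
      unfolding s_def using x by (intro DERIV_arccos) auto
    have d2: "((\<lambda>x. sqrt (1 - x\<^sup>2)) has_real_derivative (- x / s)) (at x)"
      unfolding s_def using x2 by (auto intro!: derivative_eq_intros simp: field_simps)
    have d3: "((\<lambda>x. a * sqrt (1 - x\<^sup>2) / (1 - a * x)) has_real_derivative
        ((a * (- x / s) * q - a * s * (- a)) / (q * q))) (at x)"
    proof -
      have "((\<lambda>x. a * sqrt (1 - x\<^sup>2)) has_real_derivative a * (- x / s)) (at x)"
        by (rule DERIV_cmult[OF d2])
      moreover have "((\<lambda>x. 1 - a * x) has_real_derivative - a) (at x)"
        by (auto intro!: derivative_eq_intros)
      ultimately show ?thesis
        using q unfolding q_def s_def by (intro DERIV_divide) auto
    qed
    have e3: "(a * (- x / s) * q - a * s * (- a)) / (q * q) = a * (a - x) / (s * q\<^sup>2)"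
    proof -
      have "(a * (- x / s) * q - a * s * (- a)) * s = a * (- x * q + a * s\<^sup>2)"
        using s by (simp add: field_simps power2_eq_square)
      also have "\<dots> = a * (a - x)"
        unfolding s2 q_def by (simp add: power2_eq_square algebra_simps)
      finally have "a * (- x / s) * q - a * s * (- a) = a * (a - x) / s"
        using s by (simp add: eq_divide_eq)
      then show ?thesis by (simp only: power2_eq_square divide_divide_eq_left mult.assoc)
    qed
    have d4: "((\<lambda>x. arctan (a * sqrt (1 - x\<^sup>2) / (1 - a * x))) has_real_derivative
        inverse (1 + (a * s / q)\<^sup>2) * (a * (a - x) / (s * q\<^sup>2))) (at x)"
      using DERIV_chain2[OF DERIV_arctan d3] unfolding e3 by (simp add: s_def q_def)
    have e4: "inverse (1 + (a * s / q)\<^sup>2) * (a * (a - x) / (s * q\<^sup>2)) = a * (a - x) / (s * w)"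
    proof -
      have "1 + (a * s / q)\<^sup>2 = w / q\<^sup>2"
        unfolding wq using q by (simp add: field_simps power2_eq_square)
      then show ?thesis using q s w by (simp add: field_simps)
    qed
    have "(F has_real_derivative ((1 - a\<^sup>2) / (2 * a\<^sup>2) * (a * (a - x) / (s * w))
        - inverse (- s) / 2 - (- x / s) / (2 * a))) (at x)"
      unfolding F_def
      by (intro DERIV_diff DERIV_cmult DERIV_cdivide d1 d2 d4[unfolded e4])
    moreover have "(1 - a\<^sup>2) / (2 * a\<^sup>2) * (a * (a - x) / (s * w))
        - inverse (- s) / 2 - (- x / s) / (2 * a) = s / w"
    proof -
      have num: "(1 - a\<^sup>2) * (a - x) + (a + x) * w = 2 * a * s\<^sup>2"
        unfolding s2 w_def by (simp add: power2_eq_square algebra_simps)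
      have "(1 - a\<^sup>2) / (2 * a\<^sup>2) * (a * (a - x) / (s * w))
        - inverse (- s) / 2 - (- x / s) / (2 * a) = ((1 - a\<^sup>2) * (a - x) + (a + x) * w) / (2 * a * s * w)"
        using s w a by (simp add: field_simps power2_eq_square)
      also have "\<dots> = s / w" unfolding num using s w a by (simp add: field_simps power2_eq_square)
      finally show ?thesis .
    qed
    ultimately show "(F has_vector_derivative sqrt (1 - x\<^sup>2) / (1 - 2 * a * x + a\<^sup>2)) (at x)"
      by (simp add: has_real_derivative_iff_has_vector_derivative s_def w_def)
  qed simp
  moreover have "F 1 = 0" "F (-1) = - (pi / 2)" by (simp_all add: F_def)
  ultimately show ?thesis by simp
qed

section \<open>Measures given by a density on \<open>[-1,1]\<close>\<close>

context
  fixes \<rho> :: "real \<Rightarrow> real" and I :: real and M :: "real measure"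
  assumes \<rho>_meas [measurable]: "\<rho> \<in> borel_measurable borel"
    and \<rho>_nonneg: "\<And>x. x \<in> {-1..1} \<Longrightarrow> 0 \<le> \<rho> x"
    and \<rho>_int: "(\<rho> has_integral I) {-1..1}"
    and M_eq: "M = density lborel (\<lambda>x. indicator {-1..1} x * ennreal (\<rho> x))"
begin

lemma density_Icc_real: "M = density lborel (\<lambda>x. ennreal (indicator {-1..1} x * \<rho> x))"
  unfolding M_eq by (intro density_cong) (auto split: split_indicator)

lemma density_Icc_emeasure: "emeasure M (space M) = ennreal I"
proof -
  have "emeasure M (space M) = (\<integral>\<^sup>+x. ennreal (\<rho> x) * indicator {-1..1} x \<partial>lborel)"
    unfolding M_eq by (subst emeasure_density) (auto simp: mult.commute)
  also have "\<dots> = ennreal I"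
    by (intro nn_integral_has_integral_lebesgue' \<rho>_int) (use \<rho>_nonneg in auto)
  finally show ?thesis .
qed

lemma density_Icc_finite: "finite_measure M"
  by (rule finite_measureI) (simp add: density_Icc_emeasure)

lemma density_Icc_sets: "sets M = sets borel"
  by (simp add: M_eq)

lemma density_Icc_support: "AE x in M. x \<in> {-1..1}"
  unfolding M_eq by (subst AE_density) (auto split: split_indicator)

lemma density_Icc_integral:
  assumes "f \<in> borel_measurable borel"
  shows "(\<integral>x. f x \<partial>M) = (LINT x:{-1..1}|lborel. \<rho> x * f x)"
proof -
  have "(\<integral>x. f x \<partial>M) = (\<integral>x. (indicator {-1..1} x * \<rho> x) * f x \<partial>lborel)"
    unfolding density_Icc_real using assms \<rho>_nonneg
    by (intro integral_real_density) (auto split: split_indicator)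
  then show ?thesis by (simp add: set_lebesgue_integral_def mult.assoc)
qed

lemma density_Icc_integral_1: "(\<integral>x. 1 \<partial>M) = I"
proof -
  interpret finite_measure M by (rule density_Icc_finite)
  have I: "0 \<le> I" using has_integral_nonneg[OF \<rho>_int] \<rho>_nonneg by auto
  show ?thesis using I density_Icc_emeasure by (simp add: measure_def)
qed

end

section \<open>The measures \<open>mu_c\<close> and \<open>mu_cp\<close>\<close>

lemma mu_c_density_has_integral: "((\<lambda>x. 2 / pi * sqrt (1 - x\<^sup>2)) has_integral 1) {-1..1}"
proof -
  have "((\<lambda>x. 2 / pi * sin (real (Suc 0) * arccos x)) has_integral (2 / pi * (pi / 2))) {-1..1}"
    using has_integral_mult_right[OF has_integral_sin_arccos[of 0], of "2 / pi"] by (simp only: if_True simp_thms)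
  then have "((\<lambda>x. 2 / pi * sqrt (1 - x\<^sup>2)) has_integral (2 / pi * (pi / 2))) {-1..1}"
    by (rule has_integral_eq[rotated]) (auto simp: sin_arccos)
  then show ?thesis by simp
qed

lemma mu_c_integral:
  assumes "f \<in> borel_measurable borel"
  shows "(\<integral>x. f x \<partial>mu_c) = (LINT x:{-1..1}|lborel. 2 / pi * sqrt (1 - x\<^sup>2) * f x)"
  by (rule density_Icc_integral[OF _ _ mu_c_density_has_integral mu_c_def assms])
     (auto simp: abs_square_le_1 intro!: mult_nonneg_nonneg)

lemma jacobi_measure_mu_c: "jacobi_measure mu_c 0"
proof (rule jacobi_measure.intro)
  have nn: "0 \<le> 2 / pi * sqrt (1 - x\<^sup>2)" if "x \<in> {-1..1}" for x :: real
    using that by (auto simp: abs_square_le_1 intro!: mult_nonneg_nonneg)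
  have m: "(\<lambda>x::real. 2 / pi * sqrt (1 - x\<^sup>2)) \<in> borel_measurable borel" by measurable
  show "finite_measure mu_c"
    by (rule density_Icc_finite[OF m nn mu_c_density_has_integral mu_c_def])
  show "sets mu_c = sets borel"
    by (rule density_Icc_sets[OF m nn mu_c_density_has_integral mu_c_def])
  show "AE x in mu_c. x \<in> {-1..1}"
    by (rule density_Icc_support[OF m nn mu_c_density_has_integral mu_c_def])
  fix n
  have "(\<integral>x. jpoly 0 n x \<partial>mu_c) = (LINT x:{-1..1}|lborel. 2 / pi * sqrt (1 - x\<^sup>2) * jpoly 0 n x)"
    by (rule mu_c_integral) measurable
  also have "\<dots> = (LINT x:{-1..1}|lborel. 2 / pi * sin (real (Suc n) * arccos x))"
  proof (intro set_lebesgue_integral_cong allI impI)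
    fix x :: real assume "x \<in> {-1..1}"
    then have "jpoly 0 n x * sqrt (1 - x\<^sup>2) = sin (real (Suc n) * arccos x)"
      by (intro jpoly_zero_sqrt) auto
    then show "2 / pi * sqrt (1 - x\<^sup>2) * jpoly 0 n x = 2 / pi * sin (real (Suc n) * arccos x)"
      by (metis mult.assoc mult.commute)
  qed simp
  also have "\<dots> = integral {-1..1} (\<lambda>x. 2 / pi * sin (real (Suc n) * arccos x))"
    by (intro set_borel_integral_eq_integral borel_integrable_atLeastAtMost' continuous_intros) auto
  also have "\<dots> = 2 / pi * (if n = 0 then pi / 2 else 0)"
    by (intro integral_unique has_integral_mult_right has_integral_sin_arccos)
  finally show "(\<integral>x. jpoly 0 n x \<partial>mu_c) = (if n = 0 then 1 else 0)" by simp
qed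

lemma jacobi_measure_mu_cp:
  assumes N: "N \<ge> 1"
  shows "jacobi_measure (mu_cp N) (1 / sqrt (real N))"
proof -
  define a where "a = 1 / sqrt (real N)"
  define \<rho> where "\<rho> x = 2 / pi * sqrt (1 - x\<^sup>2) / (1 - 2 * x / sqrt (real N) + 1 / real N)" for x
  define w where "w x = 1 - 2 * a * x + a\<^sup>2" for x
  have a: "0 < a" "a \<le> 1" using N by (auto simp: a_def)
  have a2: "a\<^sup>2 = 1 / real N" by (simp add: a_def power_divide)
  have \<rho>: "\<rho> x = 2 / pi * (sqrt (1 - x\<^sup>2) / w x)" for x
    unfolding \<rho>_def w_def a2 by (simp add: a_def)
  have w0: "w x \<ge> 0" if "x \<in> {-1..1}" for x
  proof -
    have "a * x \<le> a * 1" using that a by (intro mult_left_mono) auto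
    then have "(1 - a)\<^sup>2 \<le> w x" by (simp add: w_def power2_diff)
    then show ?thesis using zero_le_power2[of "1 - a"] by linarith
  qed
  \<comment> \<open>\<open>w x - (1 - a)^2 = 2 * a * (1 - x)\<close>, so \<open>w\<close> can vanish
    only at \<open>x = 1\<close>. There \<open>sqrt (1 - x^2)\<close> vanishes too, so cancelling
    \<open>w\<close> against the density is correct at every point despite division by zero.\<close>
  have w1: "w x \<noteq> 0 \<or> x = 1" if "x \<in> {-1..1}" for x
  proof (rule ccontr)
    assume c: "\<not> ?thesis"
    then have "a * x < a * 1" using that a by (intro mult_strict_left_mono) auto
    then have "(1 - a)\<^sup>2 < w x" by (simp add: w_def power2_diff)
    then show False using c zero_le_power2[of "1 - a"] by linarith
  qed
  have m [measurable]: "\<rho> \<in> borel_measurable borel" unfolding \<rho>_def by measurable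
  have nn: "0 \<le> \<rho> x" if "x \<in> {-1..1}" for x
    unfolding \<rho> using that w0[OF that] by (auto simp: abs_square_le_1 intro!: mult_nonneg_nonneg divide_nonneg_nonneg)
  have i: "(\<rho> has_integral 1) {-1..1}"
    using has_integral_mult_right[OF has_integral_sqrt_over_quadratic[OF a], of "2 / pi"]
    unfolding \<rho> w_def by simp
  have e: "mu_cp N = density lborel (\<lambda>x. indicator {-1..1} x * ennreal (\<rho> x))"
    by (simp add: mu_cp_def \<rho>_def)
  note D = m nn i e
  interpret c: jacobi_measure mu_c 0 by (rule jacobi_measure_mu_c)
  interpret finite_measure "mu_cp N" by (rule density_Icc_finite[OF D])
  have sets [measurable_cong]: "sets (mu_cp N) = sets borel" by (rule density_Icc_sets[OF D])
  have supp: "AE x in mu_cp N. x \<in> {-1..1}" by (rule density_Icc_support[OF D])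
  have int: "integrable (mu_cp N) h" if h: "continuous_on UNIV h" for h :: "real \<Rightarrow> real"
  proof -
    have "compact (h ` {-1..1})"
      by (intro compact_continuous_image continuous_on_subset[OF h]) auto
    then obtain B where B: "\<And>x. x \<in> {-1..1} \<Longrightarrow> \<bar>h x\<bar> \<le> B"
      by (metis bounded_iff compact_imp_bounded imageI real_norm_def)
    have [measurable]: "h \<in> borel_measurable borel"
      by (rule borel_measurable_continuous_onI[OF h])
    show ?thesis
    proof (rule integrable_const_bound[of _ B])
      show "AE x in mu_cp N. norm (h x) \<le> B" using supp by eventually_elim (use B in auto)
    qed measurable
  qed
  define y where "y n = (\<integral>x. jpoly 0 n x \<partial>mu_cp N)" for n
  \<comment> \<open>The recurrence for \<open>y\<close> leaves one constant free; the total mass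
    fixes it.\<close>
  have y0: "y 0 = 1" unfolding y_def jpoly.simps(1)[abs_def] by (rule density_Icc_integral_1[OF D])
  have wint: "(\<integral>x. w x * jpoly 0 n x \<partial>mu_cp N) = (if n = 0 then 1 else 0)" for n
  proof -
    have "(\<integral>x. w x * jpoly 0 n x \<partial>mu_cp N) = (LINT x:{-1..1}|lborel. \<rho> x * (w x * jpoly 0 n x))"
      unfolding w_def by (intro density_Icc_integral[OF D]) measurable
    also have "\<dots> = (LINT x:{-1..1}|lborel. 2 / pi * sqrt (1 - x\<^sup>2) * jpoly 0 n x)"
    proof (intro set_lebesgue_integral_cong allI impI)
      fix x :: real assume "x \<in> {-1..1}"
      then have "w x \<noteq> 0 \<or> x = 1" by (rule w1)
      then show "\<rho> x * (w x * jpoly 0 n x) = 2 / pi * sqrt (1 - x\<^sup>2) * jpoly 0 n x"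
        unfolding \<rho> by auto
    qed simp
    also have "\<dots> = (\<integral>x. jpoly 0 n x \<partial>mu_c)" by (rule mu_c_integral[symmetric]) measurable
    finally show ?thesis by (simp add: c.integral_jpoly)
  qed
  have ji: "integrable (mu_cp N) (jpoly 0 n)" for n
    by (intro int continuous_intros)
  \<comment> \<open>Multiplying by the denominator \<open>w\<close> reduces \<open>mu_cp\<close> to \<open>mu_c\<close>; the recurrence for \<open>w U\<^sub>n\<close> then gives
    \<open>y n = a^n\<close>.\<close>
  have diff0: "y (Suc n) - a * y n = 0" for n
  proof (induction n)
    case 0
    have "w x * jpoly 0 0 x = (1 + a\<^sup>2) * jpoly 0 0 x - a * jpoly 0 (Suc 0) x" for x
      by (simp add: w_def)
    then have "(1 + a\<^sup>2) * y 0 - a * y (Suc 0) = 1"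
      using wint[of 0] ji[of 0] ji[of "Suc 0"] unfolding y_def by (simp del: jpoly.simps)
    then have "a = y (Suc 0)"
      unfolding y0 power2_eq_square using a(1) by (simp add: distrib_right)
    then show ?case using y0 by simp
  next
    case (Suc n)
    have "w x * jpoly 0 (Suc n) x = (1 + a\<^sup>2) * jpoly 0 (Suc n) x - a * jpoly 0 (Suc (Suc n)) x - a * jpoly 0 n x" for x
      by (simp add: w_def algebra_simps)
    then have "(1 + a\<^sup>2) * y (Suc n) - a * y (Suc (Suc n)) - a * y n = 0"
      using wint[of "Suc n"] ji[of "Suc n"] ji[of "Suc (Suc n)"] ji[of n] unfolding y_def by (simp del: jpoly.simps)
    \<comment> \<open>The second-order recurrence factors: each difference equals \<open>a\<close>
      times the next one.\<close>
    then have "(y (Suc n) - a * y n) - a * (y (Suc (Suc n)) - a * y (Suc n)) = 0"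
      by (simp add: algebra_simps power2_eq_square)
    then show ?case using a Suc by simp
  qed
  have "jacobi_measure (mu_cp N) a"
  proof (rule jacobi_measure.intro)
    fix n
    show "(\<integral>x. jpoly a n x \<partial>mu_cp N) = (if n = 0 then 1 else 0)"
    proof (cases n)
      case 0 then show ?thesis using y0 by (simp add: y_def)
    next
      case (Suc k)
      have "(\<integral>x. jpoly a n x \<partial>mu_cp N) = y (Suc k) - a * y k"
        unfolding Suc jpoly_eq_jpoly_zero[of a] y_def using ji[of k] ji[of "Suc k"] by (simp del: jpoly.simps)
      then show ?thesis using diff0 Suc by simp
    qed
  qed (use supp sets finite_measure_axioms in auto)
  then show ?thesis by (simp add: a_def)
qed

section \<open>A Haar basis of the tree\<close>

text \<open>The Householder reflection exchanging the first unit vector with the constant unit vector.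
  Its row \<open>1\<close> is constant; for \<open>N = 1\<close> the denominator is \<open>0\<close> and the matrix is the identity.\<close>
definition householder :: "nat \<Rightarrow> nat \<Rightarrow> nat \<Rightarrow> real" where
  "householder N i j = of_bool (i = j) -
     (of_bool (i = 1) - 1 / sqrt (real N)) * (of_bool (j = 1) - 1 / sqrt (real N)) / (1 - 1 / sqrt (real N))"

lemma householder_1:
  assumes "j \<in> {1..N}" shows "householder N (Suc 0) j = 1 / sqrt (real N)"
proof (cases "N = 1")
  case True then show ?thesis using assms by (simp add: householder_def)
next
  case False
  then have "1 - 1 / sqrt (real N) \<noteq> 0" using assms by auto
  then show ?thesis by (simp add: householder_def)
qed

lemma householder_commute: "householder N i j = householder N j i"
  by (simp add: householder_def mult.commute eq_commute)

text \<open>For \<open>N > 1\<close> the matrix is the identity minus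
  \<open>b b^T / (1 - s)\<close>, with \<open>b\<close> the first unit vector minus the constant
  vector \<open>s = 1 / sqrt N\<close>. It is a reflection because the squared norm of
  \<open>b\<close> is \<open>2 * (1 - s)\<close>.\<close>

lemma householder_orthonormal:
  assumes i: "i \<in> {1..N}" and j: "j \<in> {1..N}"
  shows "(\<Sum>k=1..N. householder N i k * householder N j k) = of_bool (i = j)"
proof (cases "N = 1")
  case True then show ?thesis using assms by (simp add: householder_def)
next
  case False
  define s where "s = 1 / sqrt (real N)"
  define b where "b k = of_bool (k = 1) - s" for k :: nat
  have s: "1 - s \<noteq> 0" using False assms by (auto simp: s_def)
  have s2: "real N * s\<^sup>2 = 1" using assms by (simp add: s_def power_divide)
  have h: "householder N i k = of_bool (i = k) - b i * b k / (1 - s)" for i k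
    by (simp add: householder_def b_def s_def)
  have "(\<Sum>k=1..N. (b k)\<^sup>2) = (\<Sum>k=1..N. of_bool (k = 1) * (1 - 2 * s) + s\<^sup>2)"
    by (intro sum.cong) (auto simp: b_def power2_eq_square algebra_simps)
  also have "\<dots> = 2 * (1 - s)"
    using assms s2 by (simp add: sum.distrib of_bool_def if_distrib[of "\<lambda>x. x * _"] cong: if_cong)
  finally have b2: "(\<Sum>k=1..N. (b k)\<^sup>2) = 2 * (1 - s)" .
  have "householder N i k * householder N j k = (if k = i then of_bool (i = j) - b i * b j / (1 - s) else 0)
       - (if k = j then b i * b j / (1 - s) else 0) + b i * b j / (1 - s)\<^sup>2 * (b k)\<^sup>2" for k
    unfolding h by (auto simp: algebra_simps power2_eq_square)
  then have "(\<Sum>k=1..N. householder N i k * householder N j k) = of_bool (i = j) - b i * b j / (1 - s)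
       - b i * b j / (1 - s) + b i * b j / (1 - s)\<^sup>2 * (\<Sum>k=1..N. (b k)\<^sup>2)"
    using i j by (simp add: sum.distrib sum_subtractf sum_distrib_left)
  also have "\<dots> = of_bool (i = j)"
  proof -
    have "t / q\<^sup>2 * (2 * q) = 2 * (t / q)" if "q \<noteq> 0" for t q :: real
      using that by (simp add: power2_eq_square)
    from this[OF s] show ?thesis unfolding b2 by simp
  qed
  finally show ?thesis .
qed

text \<open>Up to the factor \<open>sqrt N\<close>, a row sum is the inner product with the constant
  row \<open>1\<close>. Its vanishing for \<open>j \<noteq> 1\<close> is what cuts a chain off from
  the levels above it.\<close>

lemma householder_sum:
  assumes j: "j \<in> {1..N}"
  shows "(\<Sum>i=1..N. householder N j i) = (if j = 1 then sqrt (real N) else 0)"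
proof -
  have N: "1 \<in> {1..N}" using j by auto
  have "(\<Sum>i=1..N. householder N j i * householder N 1 i) = of_bool (j = 1)"
    by (rule householder_orthonormal[OF j N])
  moreover have "(\<Sum>i=1..N. householder N j i * householder N 1 i) = (\<Sum>i=1..N. householder N j i) / sqrt (real N)"
    by (simp add: householder_1 sum_divide_distrib)
  ultimately show ?thesis using N by (auto simp: field_simps split: if_splits)
qed

definition tree_level :: "nat \<Rightarrow> nat \<Rightarrow> nat list set" where
  "tree_level N L = {w. set w \<subseteq> {1..N} \<and> length w = L}"

lemma finite_tree_level [simp]: "finite (tree_level N L)"
  unfolding tree_level_def by (rule finite_lists_length_eq) simp

lemma tree_level_0: "tree_level N 0 = {[]}"
  by (auto simp: tree_level_def)

lemma snoc_tree_level [simp]: "w @ [j] \<in> tree_level N (Suc L) \<longleftrightarrow> w \<in> tree_level N L \<and> j \<in> {1..N}"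
  by (auto simp: tree_level_def)

lemma tree_level_SucE:
  assumes "w \<in> tree_level N (Suc L)"
  obtains u j where "w = u @ [j]" "u \<in> tree_level N L" "j \<in> {1..N}"
  using assms by (cases w rule: rev_cases) (auto simp: tree_level_def)

lemma tree_V_tree_level: "w \<in> tree_V N \<longleftrightarrow> w \<in> tree_level N (length w)"
  by (auto simp: tree_V_def tree_level_def)

lemma sum_tree_level_Suc:
  "(\<Sum>x\<in>tree_level N (Suc L). f x) = (\<Sum>x\<in>tree_level N L. \<Sum>i=1..N. f (x @ [i]))"
proof -
  have "bij_betw (\<lambda>(x, i). x @ [i]) (tree_level N L \<times> {1..N}) (tree_level N (Suc L))"
    by (auto simp: bij_betw_def inj_on_def image_iff elim!: tree_level_SucE)
  then have "(\<Sum>x\<in>tree_level N (Suc L). f x) = (\<Sum>p\<in>tree_level N L \<times> {1..N}. f (case p of (x, i) \<Rightarrow> x @ [i]))"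
    by (rule sum.reindex_bij_betw[symmetric])
  then show ?thesis by (simp add: sum.cartesian_product case_prod_beta)
qed

text \<open>The Haar-type function with index \<open>u @ [j] @ replicate k 1\<close>, \<open>j \<noteq> 1\<close>, lives on the level of its
  index, \<open>k + 1\<close> levels below \<open>u\<close>: it is row \<open>j\<close> of the Householder matrix in the letter following
  \<open>u\<close> and constant in the last \<open>k\<close> letters. The index \<open>replicate k 1\<close> gives the normalised
  indicator of level \<open>k\<close>. The recursion reads words from their last letter.\<close>
fun haar_rev :: "nat \<Rightarrow> nat list \<Rightarrow> nat list \<Rightarrow> real" where
  "haar_rev N [] x = of_bool (x = [])"
| "haar_rev N (j # w) [] = 0"
| "haar_rev N (j # w) (i # x) = householder N j i * (if j = 1 then haar_rev N w x else of_bool (w = x))"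

definition haar :: "nat \<Rightarrow> nat list \<Rightarrow> nat list \<Rightarrow> real" where
  "haar N w x = haar_rev N (rev w) (rev x)"

lemma haar_Nil: "haar N [] [] = 1"
  by (simp add: haar_def)

lemma haar_snoc:
  "haar N (w @ [j]) (x @ [i]) = householder N j i * (if j = 1 then haar N w x else of_bool (w = x))"
  by (simp add: haar_def)

text \<open>The sum splits into a Householder product in the last letter and a sum over the previous
  level. The first factor forces equal last letters; the second is the induction hypothesis for
  letter \<open>1\<close> and a sum of point masses otherwise.\<close>

lemma haar_orthonormal:
  assumes "w \<in> tree_level N L" "w' \<in> tree_level N L"
  shows "(\<Sum>x\<in>tree_level N L. haar N w x * haar N w' x) = of_bool (w = w')"
  using assms
proof (induction L arbitrary: w w')
  case 0 then show ?case by (simp add: tree_level_0 haar_Nil)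
next
  case (Suc L)
  obtain u j where w: "w = u @ [j]" "u \<in> tree_level N L" "j \<in> {1..N}" using Suc.prems(1) by (rule tree_level_SucE)
  obtain u' j' where w': "w' = u' @ [j']" "u' \<in> tree_level N L" "j' \<in> {1..N}" using Suc.prems(2) by (rule tree_level_SucE)
  define G where "G j u x = (if j = 1 then haar N u x else of_bool (u = x))" for j :: nat and u x
  have "(\<Sum>x\<in>tree_level N (Suc L). haar N w x * haar N w' x)
      = (\<Sum>x\<in>tree_level N L. \<Sum>i=1..N. (householder N j i * householder N j' i) * (G j u x * G j' u' x))"
    unfolding sum_tree_level_Suc w w' haar_snoc G_def by (simp add: mult_ac)
  also have "\<dots> = (\<Sum>i=1..N. householder N j i * householder N j' i) * (\<Sum>x\<in>tree_level N L. G j u x * G j' u' x)"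
    by (simp only: sum_distrib_right[symmetric] sum_distrib_left[symmetric])
  also have "\<dots> = of_bool (j = j') * (\<Sum>x\<in>tree_level N L. G j u x * G j' u' x)"
    by (simp only: householder_orthonormal[OF w(3) w'(3)])
  also have "\<dots> = of_bool (w = w')"
  proof (cases "j = j'")
    case False then show ?thesis by (simp add: w w')
  next
    case j: True
    have "(\<Sum>x\<in>tree_level N L. G j u x * G j u' x) = of_bool (u = u')"
    proof (cases "j = 1")
      case True then show ?thesis using Suc.IH[OF w(2) w'(2)] by (simp add: G_def)
    next
      case False
      have "(\<Sum>x\<in>tree_level N L. G j u x * G j u' x) = (\<Sum>x\<in>tree_level N L. if x = u then of_bool (u = u') else 0)"
        using False by (intro sum.cong) (auto simp: G_def)
      then show ?thesis using w(2) by simp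
    qed
    then show ?thesis using j by (simp add: w w')
  qed
  finally show ?case .
qed

text \<open>The column version of \<open>haar_orthonormal\<close>, reduced to rows by the symmetry
  of the Householder matrix. Rows yield the inverse transform, columns the isometry.\<close>

lemma haar_complete:
  assumes "x \<in> tree_level N L" "y \<in> tree_level N L"
  shows "(\<Sum>w\<in>tree_level N L. haar N w x * haar N w y) = of_bool (x = y)"
  using assms
proof (induction L arbitrary: x y)
  case 0 then show ?case by (simp add: tree_level_0 haar_Nil)
next
  case (Suc L)
  obtain u i where x: "x = u @ [i]" "u \<in> tree_level N L" "i \<in> {1..N}" using Suc.prems(1) by (rule tree_level_SucE)
  obtain v k where y: "y = v @ [k]" "v \<in> tree_level N L" "k \<in> {1..N}" using Suc.prems(2) by (rule tree_level_SucE)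
  have inner: "(\<Sum>w\<in>tree_level N L. (if j = 1 then haar N w u else of_bool (w = u)) *
      (if j = 1 then haar N w v else of_bool (w = v))) = of_bool (u = v)" for j :: nat
  proof (cases "j = 1")
    case True then show ?thesis using Suc.IH[OF x(2) y(2)] by simp
  next
    case False
    have "(\<Sum>w\<in>tree_level N L. of_bool (w = u) * of_bool (w = v)) = (\<Sum>w\<in>tree_level N L. if w = u then of_bool (u = v) else (0::real))"
      by (intro sum.cong) auto
    then show ?thesis using x(2) False by simp
  qed
  have "(\<Sum>w\<in>tree_level N (Suc L). haar N w x * haar N w y)
      = (\<Sum>j=1..N. \<Sum>w\<in>tree_level N L. (householder N j i * householder N j k) *
        ((if j = 1 then haar N w u else of_bool (w = u)) * (if j = 1 then haar N w v else of_bool (w = v))))"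
    unfolding sum_tree_level_Suc x y haar_snoc by (subst sum.swap) (simp add: mult_ac)
  also have "\<dots> = (\<Sum>j=1..N. householder N i j * householder N k j) * of_bool (u = v)"
    by (simp only: sum_distrib_left[symmetric] inner sum_distrib_right householder_commute[of N i] householder_commute[of N k])
  also have "\<dots> = of_bool (x = y)"
    unfolding householder_orthonormal[OF x(3) y(3)] x y by auto
  finally show ?case .
qed

text \<open>Each Haar function lives on one finite level, so the coefficient is a finite sum and
  exists for every \<open>v\<close>, including images under the Laplacian.\<close>

definition haar_coef :: "nat \<Rightarrow> (nat list \<Rightarrow> complex) \<Rightarrow> nat list \<Rightarrow> complex" where
  "haar_coef N v w = (\<Sum>x\<in>tree_level N (length w). haar N w x *\<^sub>R v x)"

lemma haar_coef_lincomb: "haar_coef N (\<lambda>x. a * v x + b * u x) w = a * haar_coef N v w + b * haar_coef N u w"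
  by (simp add: haar_coef_def sum_distrib_left sum.distrib[symmetric] scaleR_conv_of_real algebra_simps)

definition haar_synth :: "nat \<Rightarrow> (nat list \<Rightarrow> complex) \<Rightarrow> nat list \<Rightarrow> complex" where
  "haar_synth N d x = (if x \<in> tree_V N then \<Sum>w\<in>tree_level N (length x). haar N w x *\<^sub>R d w else 0)"

lemma haar_coef_haar_synth:
  assumes w: "w \<in> tree_V N" shows "haar_coef N (haar_synth N d) w = d w"
proof -
  define L where "L = length w"
  have wL: "w \<in> tree_level N L" using w by (simp add: tree_V_tree_level L_def)
  have "haar_coef N (haar_synth N d) w = (\<Sum>x\<in>tree_level N L. haar N w x *\<^sub>R (\<Sum>u\<in>tree_level N L. haar N u x *\<^sub>R d u))"
    unfolding haar_coef_def L_def[symmetric]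
    by (intro sum.cong) (auto simp: haar_synth_def tree_level_def tree_V_def)
  also have "\<dots> = (\<Sum>u\<in>tree_level N L. (\<Sum>x\<in>tree_level N L. haar N w x * haar N u x) *\<^sub>R d u)"
    unfolding scaleR_sum_right scaleR_sum_left by (subst sum.swap) simp
  also have "\<dots> = (\<Sum>u\<in>tree_level N L. if u = w then d u else 0)"
    by (intro sum.cong refl) (auto simp: haar_orthonormal[OF wL])
  finally show ?thesis using wL by simp
qed

lemma haar_coef_level_norm:
  "(\<Sum>w\<in>tree_level N L. (cmod (haar_coef N v w))\<^sup>2) = (\<Sum>x\<in>tree_level N L. (cmod (v x))\<^sup>2)"
proof -
  have "(\<Sum>w\<in>tree_level N L. (cmod (haar_coef N v w))\<^sup>2)
      = (\<Sum>w\<in>tree_level N L. \<Sum>x\<in>tree_level N L. \<Sum>y\<in>tree_level N L. (haar N w x * haar N w y) * inner (v x) (v y))"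
  proof (intro sum.cong refl)
    fix w assume "w \<in> tree_level N L"
    then have "length w = L" by (simp add: tree_level_def)
    then show "(cmod (haar_coef N v w))\<^sup>2 = (\<Sum>x\<in>tree_level N L. \<Sum>y\<in>tree_level N L. (haar N w x * haar N w y) * inner (v x) (v y))"
      unfolding haar_coef_def power2_norm_eq_inner inner_sum_left
      by (simp only: inner_sum_right inner_scaleR_left inner_scaleR_right mult.assoc mult.left_commute)
  qed
  also have "\<dots> = (\<Sum>x\<in>tree_level N L. \<Sum>w\<in>tree_level N L. \<Sum>y\<in>tree_level N L. (haar N w x * haar N w y) * inner (v x) (v y))"
    by (rule sum.swap)
  also have "\<dots> = (\<Sum>x\<in>tree_level N L. \<Sum>y\<in>tree_level N L. (\<Sum>w\<in>tree_level N L. haar N w x * haar N w y) * inner (v x) (v y))"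
    unfolding sum_distrib_right by (intro sum.cong refl sum.swap)
  also have "\<dots> = (\<Sum>x\<in>tree_level N L. \<Sum>y\<in>tree_level N L. if y = x then inner (v x) (v y) else 0)"
    by (intro sum.cong refl) (auto simp: haar_complete)
  also have "\<dots> = (\<Sum>x\<in>tree_level N L. (cmod (v x))\<^sup>2)"
    by (simp add: power2_norm_eq_inner)
  finally show ?thesis .
qed

text \<open>Every finite set of vertices lies in finitely many levels, where the two sums agree.
  Using the lemma again with \<open>f\<close> and \<open>g\<close> exchanged gives equality of the
  infinite sums.\<close>

lemma summable_on_levelwise_le:
  fixes f g :: "nat list \<Rightarrow> real"
  assumes f: "f summable_on tree_V N" and f0: "\<And>x. 0 \<le> f x" and g0: "\<And>x. 0 \<le> g x"
    and eq: "\<And>L. (\<Sum>x\<in>tree_level N L. f x) = (\<Sum>x\<in>tree_level N L. g x)"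
  shows "g summable_on tree_V N \<and> infsum g (tree_V N) \<le> infsum f (tree_V N)"
proof -
  have le: "sum g F \<le> infsum f (tree_V N)" if F: "finite F" "F \<subseteq> tree_V N" for F
  proof -
    \<comment> \<open>Inserting \<open>0\<close> keeps \<open>Max\<close> meaningful for empty
      \<open>F\<close>.\<close>
    define n where "n = Suc (Max (insert 0 (length ` F)))"
    have Fn: "F \<subseteq> (\<Union>L<n. tree_level N L)"
    proof
      fix x assume x: "x \<in> F"
      then have "length x < n" using F by (auto simp: n_def less_Suc_eq_le intro!: Max_ge)
      then show "x \<in> (\<Union>L<n. tree_level N L)" using x F by (auto simp: tree_V_def tree_level_def)
    qed
    have disj: "(\<Sum>x\<in>(\<Union>L<n. tree_level N L). h x) = (\<Sum>L<n. \<Sum>x\<in>tree_level N L. h x)" for h :: "nat list \<Rightarrow> real"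
      by (intro sum.UNION_disjoint) (auto simp: tree_level_def[of N] finite_lists_length_eq)
    have "sum g F \<le> (\<Sum>x\<in>(\<Union>L<n. tree_level N L). g x)"
      using Fn g0 by (intro sum_mono2) auto
    also have "\<dots> = (\<Sum>x\<in>(\<Union>L<n. tree_level N L). f x)" unfolding disj eq ..
    also have "\<dots> \<le> infsum f (tree_V N)"
      using f f0 by (intro finite_sum_le_infsum) (auto simp: tree_level_def[of N] tree_V_def finite_lists_length_eq)
    finally show ?thesis .
  qed
  have g: "g summable_on tree_V N"
    using le g0 by (intro nonneg_bdd_above_summable_on bdd_aboveI2[of _ _ "infsum f (tree_V N)"]) auto
  show ?thesis using g infsum_le_finite_sums[OF g le] by simp
qed

lemma haar_coef_summable_iff:
  "(\<lambda>w. (cmod (haar_coef N v w))\<^sup>2) summable_on tree_V N \<longleftrightarrow> (\<lambda>x. (cmod (v x))\<^sup>2) summable_on tree_V N"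
  using summable_on_levelwise_le[of "\<lambda>x. (cmod (v x))\<^sup>2" N "\<lambda>w. (cmod (haar_coef N v w))\<^sup>2"]
    summable_on_levelwise_le[of "\<lambda>w. (cmod (haar_coef N v w))\<^sup>2" N "\<lambda>x. (cmod (v x))\<^sup>2"]
  by (auto simp: haar_coef_level_norm)

lemma haar_coef_normsq:
  assumes "(\<lambda>x. (cmod (v x))\<^sup>2) summable_on tree_V N"
  shows "(\<Sum>\<^sub>\<infinity>w\<in>tree_V N. (cmod (haar_coef N v w))\<^sup>2) = l2V_normsq N v"
  using summable_on_levelwise_le[of "\<lambda>x. (cmod (v x))\<^sup>2" N "\<lambda>w. (cmod (haar_coef N v w))\<^sup>2"]
    summable_on_levelwise_le[of "\<lambda>w. (cmod (haar_coef N v w))\<^sup>2" N "\<lambda>x. (cmod (v x))\<^sup>2"] assms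
  unfolding l2V_normsq_def by (auto simp: haar_coef_level_norm haar_coef_summable_iff intro!: antisym)

section \<open>The Laplacian in Haar coordinates\<close>

lemma tree_laplacian_Nil:
  "tree_laplacian N v [] = of_nat N * v [] - (\<Sum>i=1..N. v [i])"
proof -
  have "{y. tree_adj N [] y} = (\<lambda>i. [i]) ` {1..N}"
    by (auto simp: tree_adj_def tree_V_def)
  then have "tree_laplacian N v [] = (\<Sum>y\<in>(\<lambda>i. [i]) ` {1..N}. v [] - v y)"
    by (simp add: tree_laplacian_def tree_V_def)
  also have "\<dots> = (\<Sum>i=1..N. v [] - v [i])"
    by (subst sum.reindex) (auto simp: inj_on_def)
  finally show ?thesis by (simp add: sum_subtractf)
qed

lemma tree_laplacian_snoc:
  assumes "x \<in> tree_V N" "j \<in> {1..N}"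
  shows "tree_laplacian N v (x @ [j]) = (of_nat N + 1) * v (x @ [j]) - (\<Sum>i=1..N. v (x @ [j] @ [i])) - v x"
proof -
  let ?C = "(\<lambda>i. x @ [j] @ [i]) ` {1..N}"
  have "{y. tree_adj N (x @ [j]) y} = insert x ?C"
    using assms by (auto simp: tree_adj_def tree_V_def)
  then have "tree_laplacian N v (x @ [j]) = (\<Sum>y\<in>insert x ?C. v (x @ [j]) - v y)"
    using assms by (simp add: tree_laplacian_def tree_V_def)
  also have "\<dots> = (v (x @ [j]) - v x) + (\<Sum>y\<in>?C. v (x @ [j]) - v y)"
    by (subst sum.insert) auto
  also have "(\<Sum>y\<in>?C. v (x @ [j]) - v y) = (\<Sum>i=1..N. v (x @ [j]) - v (x @ [j] @ [i]))"
    by (subst sum.reindex) (auto simp: inj_on_def)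
  finally show ?thesis by (simp add: sum_subtractf algebra_simps)
qed

text \<open>Row \<open>1\<close> is constant, so appending the letter \<open>1\<close> to the index
  averages over children. The child sum in the Laplacian thus becomes a shift along the
  chain.\<close>

lemma haar_coef_snoc_1:
  "sqrt (real N) *\<^sub>R haar_coef N v (w @ [Suc 0]) = (\<Sum>x\<in>tree_level N (length w). haar N w x *\<^sub>R (\<Sum>i=1..N. v (x @ [i])))"
proof (cases "N = 0")
  case True then show ?thesis by simp
next
  case False
  have "haar_coef N v (w @ [Suc 0]) = (\<Sum>x\<in>tree_level N (length w). \<Sum>i=1..N. (1 / sqrt (real N) * haar N w x) *\<^sub>R v (x @ [i]))"
    by (simp add: haar_coef_def sum_tree_level_Suc haar_snoc householder_1)
  also have "\<dots> = (1 / sqrt (real N)) *\<^sub>R (\<Sum>x\<in>tree_level N (length w). haar N w x *\<^sub>R (\<Sum>i=1..N. v (x @ [i])))"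
    unfolding scaleR_sum_right scaleR_scaleR ..
  finally show ?thesis using False by simp
qed

lemma haar_coef_laplacian_Nil:
  "haar_coef N (tree_laplacian N v) [] = real N *\<^sub>R haar_coef N v [] - sqrt (real N) *\<^sub>R haar_coef N v [Suc 0]"
  using haar_coef_snoc_1[of N v "[]"]
  by (simp add: haar_coef_def tree_level_0 haar_Nil tree_laplacian_Nil scaleR_conv_of_real)

text \<open>The three terms come from the degree, the children and the parent. For
  \<open>j = 1\<close> they form an interior row of \<open>N + 1 - 2 * sqrt N * J\<close>; for
  \<open>j \<noteq> 1\<close> they form the first row of a chain with diagonal
  \<open>0\<close>.\<close>

lemma haar_coef_laplacian_snoc:
  assumes w: "w \<in> tree_V N" and j: "j \<in> {1..N}"
  shows "haar_coef N (tree_laplacian N v) (w @ [j]) = (real N + 1) *\<^sub>R haar_coef N v (w @ [j])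
     - sqrt (real N) *\<^sub>R haar_coef N v (w @ [j] @ [Suc 0])
     - (if j = 1 then sqrt (real N) *\<^sub>R haar_coef N v w else 0)"
proof -
  let ?w = "w @ [j]"
  define L where "L = length w"
  \<comment> \<open>The value at the parent is the same for all siblings, so only the row sum of the
    Householder matrix remains.\<close>
  have par: "(\<Sum>x\<in>tree_level N L. \<Sum>i=1..N. haar N ?w (x @ [i]) *\<^sub>R v x)
      = (if j = 1 then sqrt (real N) *\<^sub>R haar_coef N v w else 0)"
  proof -
    have "(\<Sum>x\<in>tree_level N L. \<Sum>i=1..N. haar N ?w (x @ [i]) *\<^sub>R v x)
      = (\<Sum>x\<in>tree_level N L. ((\<Sum>i=1..N. householder N j i) * (if j = 1 then haar N w x else of_bool (w = x))) *\<^sub>R v x)"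
      by (simp add: haar_snoc sum_distrib_right scaleR_sum_left)
    also have "\<dots> = (if j = 1 then sqrt (real N) *\<^sub>R haar_coef N v w else 0)"
      unfolding householder_sum[OF j] haar_coef_def L_def by (simp add: scaleR_sum_right)
    finally show ?thesis .
  qed
  have "haar_coef N (tree_laplacian N v) ?w
      = (\<Sum>x\<in>tree_level N L. \<Sum>i=1..N. haar N ?w (x @ [i]) *\<^sub>R tree_laplacian N v (x @ [i]))"
    by (simp add: haar_coef_def sum_tree_level_Suc L_def)
  also have "\<dots> = (\<Sum>x\<in>tree_level N L. \<Sum>i=1..N. (real N + 1) *\<^sub>R (haar N ?w (x @ [i]) *\<^sub>R v (x @ [i]))
      - haar N ?w (x @ [i]) *\<^sub>R (\<Sum>k=1..N. v ((x @ [i]) @ [k])) - haar N ?w (x @ [i]) *\<^sub>R v x)"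
  proof (intro sum.cong refl)
    fix x i assume "x \<in> tree_level N L" "i \<in> {1..N}"
    then have lap: "tree_laplacian N v (x @ [i]) = (of_nat N + 1) * v (x @ [i]) - (\<Sum>k=1..N. v ((x @ [i]) @ [k])) - v x"
      using tree_laplacian_snoc[of x N i v] by (simp add: tree_V_def tree_level_def)
    show "haar N ?w (x @ [i]) *\<^sub>R tree_laplacian N v (x @ [i])
      = (real N + 1) *\<^sub>R (haar N ?w (x @ [i]) *\<^sub>R v (x @ [i]))
      - haar N ?w (x @ [i]) *\<^sub>R (\<Sum>k=1..N. v ((x @ [i]) @ [k])) - haar N ?w (x @ [i]) *\<^sub>R v x"
      unfolding lap by (simp add: scaleR_conv_of_real algebra_simps)
  qed
  also have "\<dots> = (real N + 1) *\<^sub>R (\<Sum>x\<in>tree_level N L. \<Sum>i=1..N. haar N ?w (x @ [i]) *\<^sub>R v (x @ [i]))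
      - (\<Sum>x\<in>tree_level N L. \<Sum>i=1..N. haar N ?w (x @ [i]) *\<^sub>R (\<Sum>k=1..N. v ((x @ [i]) @ [k])))
      - (\<Sum>x\<in>tree_level N L. \<Sum>i=1..N. haar N ?w (x @ [i]) *\<^sub>R v x)"
    by (simp only: sum_subtractf scaleR_sum_right)
  also have "(\<Sum>x\<in>tree_level N L. \<Sum>i=1..N. haar N ?w (x @ [i]) *\<^sub>R v (x @ [i])) = haar_coef N v ?w"
    by (simp add: haar_coef_def sum_tree_level_Suc L_def)
  also have "(\<Sum>x\<in>tree_level N L. \<Sum>i=1..N. haar N ?w (x @ [i]) *\<^sub>R (\<Sum>k=1..N. v ((x @ [i]) @ [k])))
      = sqrt (real N) *\<^sub>R haar_coef N v (?w @ [Suc 0])"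
    unfolding haar_coef_snoc_1 by (simp add: sum_tree_level_Suc L_def)
  finally show ?thesis unfolding par by simp
qed

section \<open>The unitary equivalence\<close>

text \<open>Every word is uniquely a head followed by letters \<open>1\<close>; the Laplacian only moves along these
  trailing letters, so each head spans an invariant subspace.\<close>
definition heads :: "nat \<Rightarrow> nat list set" where
  "heads N = {w \<in> tree_V N. w = [] \<or> last w \<noteq> 1}"

lemma bij_betw_heads_tails:
  assumes N: "N \<ge> 1"
  shows "bij_betw (\<lambda>(u, k). u @ replicate k 1) (heads N \<times> UNIV) (tree_V N)"
proof (rule bij_betw_imageI)
  have rep_snoc: "replicate (Suc k) (1::nat) = replicate k 1 @ [1]" for k
    by (simp add: replicate_append_same)
  have head_neq: "u \<noteq> x @ [1]" if "u \<in> heads N" for u x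
    using that by (auto simp: heads_def)
  \<comment> \<open>Strip final letters \<open>1\<close> from both sides; heads do not end in
    \<open>1\<close>, so both exponents run out together.\<close>
  have sk: "u = u' \<and> k = k'"
    if "u \<in> heads N" "u' \<in> heads N" "u @ replicate k 1 = u' @ replicate k' 1" for u u' k k'
    using that
  proof (induction k arbitrary: k')
    case 0
    show ?case
    proof (cases k')
      case (Suc l)
      then have "u = (u' @ replicate l 1) @ [1]" using 0(3) by (simp only: rep_snoc append_assoc) simp
      then show ?thesis using head_neq[OF 0(1)] by blast
    qed (use 0 in simp)
  next
    case (Suc k)
    note prems = Suc.prems and IH = Suc.IH
    show ?case
    proof (cases k')
      case 0
      then have "u' = (u @ replicate k 1) @ [1]" using prems(3) by (simp only: rep_snoc append_assoc) simp
      then show ?thesis using head_neq[OF prems(2)] by blast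
    next
      case (Suc l)
      have "(u @ replicate k 1) @ [1] = (u' @ replicate l 1) @ [1]"
        using prems(3) unfolding Suc rep_snoc append_assoc .
      then have "u @ replicate k 1 = u' @ replicate l 1" by (rule append_same_eq[THEN iffD1])
      then have "u = u' \<and> k = l" by (rule IH[OF prems(1,2)])
      then show ?thesis using Suc by simp
    qed
  qed
  show "inj_on (\<lambda>(u, k). u @ replicate k 1) (heads N \<times> UNIV)"
  proof (rule inj_onI)
    fix p q :: "nat list \<times> nat"
    assume "p \<in> heads N \<times> UNIV" "q \<in> heads N \<times> UNIV"
      "(case p of (u, k) \<Rightarrow> u @ replicate k 1) = (case q of (u, k) \<Rightarrow> u @ replicate k 1)"
    then show "p = q" using sk[of "fst p" "fst q" "snd p" "snd q"] by (simp add: case_prod_beta prod_eq_iff mem_Times_iff)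
  qed
  have dec: "\<exists>u\<in>heads N. \<exists>k. w = u @ replicate k 1" if "w \<in> tree_V N" for w
    using that
  proof (induction w rule: rev_induct)
    case Nil
    then show ?case by (auto simp: heads_def intro!: bexI[of _ "[]"] exI[of _ 0])
  next
    case (snoc j w)
    show ?case
    proof (cases "j = 1")
      case True
      have "w \<in> tree_V N" using snoc.prems by (simp add: tree_V_def)
      then obtain u k where "u \<in> heads N" "w = u @ replicate k 1" using snoc.IH by blast
      then show ?thesis using True
        by (intro bexI[of _ u] exI[of _ "Suc k"]) (auto simp: replicate_append_same)
    next
      case False
      then show ?thesis using snoc.prems
        by (intro bexI[of _ "w @ [j]"] exI[of _ 0]) (auto simp: heads_def)
    qed
  qed
  show "(\<lambda>(u, k). u @ replicate k 1) ` (heads N \<times> UNIV) = tree_V N"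
  proof (intro equalityI subsetI)
    fix w assume "w \<in> (\<lambda>(u, k). u @ replicate k 1) ` (heads N \<times> UNIV)"
    then obtain u k where "u \<in> heads N" "w = u @ replicate k 1" by auto
    then show "w \<in> tree_V N" using N by (auto simp: heads_def tree_V_def set_replicate_conv_if)
  next
    fix w assume "w \<in> tree_V N"
    then obtain u k where "u \<in> heads N" "w = u @ replicate k 1" using dec by blast
    then show "w \<in> (\<lambda>(u, k). u @ replicate k 1) ` (heads N \<times> UNIV)"
      by (intro image_eqI[of _ _ "(u, k)"]) auto
  qed
qed

text \<open>The arbitrary index set covers a single head as well as infinitely many. Component
  \<open>n\<close> of \<open>U v\<close> has as Fourier coefficients the Haar coefficients of
  \<open>v\<close> along the chain of \<open>e n\<close>; the two Parseval identities make
  \<open>U\<close> isometric.\<close>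

lemma laplacian_equiv_jacobi:
  fixes e :: "nat \<Rightarrow> nat list"
  assumes N: "N \<ge> 1" and e: "bij_betw e I (heads N)"
    and M: "\<And>n. n \<in> I \<Longrightarrow> jacobi_measure (M n) (if e n = [] then 1 / sqrt (real N) else 0)"
    and g: "\<And>x. g x = real N + 1 - 2 * sqrt (real N) * x"
  shows "lap_unitarily_equiv_mult N I M g"
proof -
  define idx where "idx n k = e n @ replicate k (1::nat)" for n k
  define A where "A n = (if e n = [] then 1 / sqrt (real N) else 0)" for n
  define fc where "fc n = jacobi_measure.fourier (M n) (A n)" for n
  have J: "jacobi_measure (M n) (A n)" if "n \<in> I" for n using M[OF that] by (simp add: A_def)
  have en: "e n \<in> heads N" if "n \<in> I" for n using e that by (auto simp: bij_betw_def)
  have bij: "bij_betw (\<lambda>(n, k). idx n k) (I \<times> UNIV) (tree_V N)"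
  proof -
    have "bij_betw (map_prod e id) (I \<times> UNIV) (heads N \<times> (UNIV :: nat set))"
      by (intro bij_betw_map_prod e bij_betw_id)
    from bij_betw_trans[OF this bij_betw_heads_tails[OF N]] show ?thesis
      by (simp add: idx_def o_def case_prod_unfold)
  qed
  have idx_V: "idx n k \<in> tree_V N" if "n \<in> I" for n k
    using bij that by (auto simp: bij_betw_def)
  \<comment> \<open>\<open>U v n\<close> is chosen by its Fourier coefficients, so that linearity and the intertwining relation
    follow from uniqueness of the coefficients.\<close>
  define ok where "ok v n f \<longleftrightarrow> f \<in> L2 (M n) \<and> (\<forall>k. fc n f k = haar_coef N v (idx n k))" for v n f
  define U where "U v n = (if n \<in> I then SOME f. ok v n f else (\<lambda>_. 0))" for v n
  have U_ok: "ok v n (U v n)" if "ok v n f" "n \<in> I" for v n f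
    using someI[of "ok v n" f] that by (simp add: U_def)
  have uniq: "AE x in M n. f x = f' x"
    if "n \<in> I" "f \<in> L2 (M n)" "f' \<in> L2 (M n)" "\<And>k. fc n f k = fc n f' k" for n f f'
    using jacobi_measure.fourier_eq_imp_AE_eq[OF J] that unfolding fc_def by blast
  have U_eq: "AE x in M n. U v n x = f x" if "ok v n f" "n \<in> I" for v n f
    using uniq[OF that(2), of "U v n" f] U_ok[OF that] that unfolding ok_def by auto
  have sum2: "(\<lambda>(n, k). (cmod (haar_coef N v (idx n k)))\<^sup>2) summable_on I \<times> UNIV \<longleftrightarrow>
      (\<lambda>w. (cmod (haar_coef N v w))\<^sup>2) summable_on tree_V N" for v
    using summable_on_reindex_bij_betw[OF bij, of "\<lambda>w. (cmod (haar_coef N v w))\<^sup>2"]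
    by (simp add: case_prod_unfold)
  have inf2: "(\<Sum>\<^sub>\<infinity>(n, k)\<in>I \<times> UNIV. (cmod (haar_coef N v (idx n k)))\<^sup>2) =
      (\<Sum>\<^sub>\<infinity>w\<in>tree_V N. (cmod (haar_coef N v w))\<^sup>2)" for v
    using infsum_reindex_bij_betw[OF bij, of "\<lambda>w. (cmod (haar_coef N v w))\<^sup>2"]
    by (simp add: case_prod_unfold)
  have S: "(\<lambda>(n, k). (cmod (haar_coef N v (idx n k)))\<^sup>2) summable_on I \<times> UNIV" if "v \<in> l2V N" for v
    using that unfolding sum2 haar_coef_summable_iff by (simp add: l2V_def)
  have ok_ex: "ok v n (U v n)" if v: "v \<in> l2V N" and n: "n \<in> I" for v n
  proof -
    have "(\<lambda>k. (cmod (haar_coef N v (idx n k)))\<^sup>2) summable_on UNIV"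
      using summable_on_SigmaD1[OF S[OF v] n] .
    then have "summable (\<lambda>k. (cmod (haar_coef N v (idx n k)))\<^sup>2)"
      by (rule summable_on_imp_summable)
    from jacobi_measure.riesz_fischer[OF J[OF n] this] obtain f where "ok v n f"
      unfolding ok_def fc_def by blast
    then show ?thesis by (rule U_ok[OF _ n])
  qed
  have pars: "((\<lambda>k. (cmod (fc n f k))\<^sup>2) has_sum L2_normsq (M n) f) UNIV"
    if "n \<in> I" "f \<in> L2 (M n)" for n f
    using jacobi_measure.parseval[OF J] that unfolding fc_def by blast
  have normU: "L2_normsq (M n) (U v n) = (\<Sum>\<^sub>\<infinity>k\<in>UNIV. (cmod (haar_coef N v (idx n k)))\<^sup>2)"
    if "v \<in> l2V N" "n \<in> I" for v n
    using pars[OF that(2), of "U v n"] ok_ex[OF that] unfolding ok_def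
    by (metis (no_types, lifting) infsumI infsum_cong)
  have lin: "ok (\<lambda>x. a * v x + b * w x) n (\<lambda>t. a * U v n t + b * U w n t)"
    if v: "v \<in> l2V N" and w: "w \<in> l2V N" and n: "n \<in> I" for v w a b n
  proof -
    interpret jacobi_measure "M n" "A n" by (rule J[OF n])
    have "U v n \<in> L2 (M n)" "U w n \<in> L2 (M n)" "\<And>k. fc n (U v n) k = haar_coef N v (idx n k)"
        "\<And>k. fc n (U w n) k = haar_coef N w (idx n k)"
      using ok_ex[OF v n] ok_ex[OF w n] by (auto simp: ok_def)
    then show ?thesis unfolding ok_def fc_def
      by (simp add: L2_lincomb fourier_lincomb L2_integrable haar_coef_lincomb)
  qed
  \<comment> \<open>The product \<open>g * U v n\<close> is itself a witness of \<open>ok\<close>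
    for the image \<open>tree_laplacian N v\<close>.\<close>
  have mult: "ok (tree_laplacian N v) n (\<lambda>t. complex_of_real (g t) * U v n t)"
    if v: "v \<in> l2V N" and n: "n \<in> I" for v n
  proof -
    interpret jacobi_measure "M n" "A n" by (rule J[OF n])
    let ?f = "U v n"
    have f: "?f \<in> L2 (M n)" and fk: "\<And>k. fourier ?f k = haar_coef N v (idx n k)"
      using ok_ex[OF v n] by (auto simp: ok_def fc_def)
    have fi: "integrable (M n) ?f" by (rule L2_integrable[OF f])
    have xf: "(\<lambda>t. complex_of_real t * ?f t) \<in> L2 (M n)"
      by (intro L2_continuous_mult f continuous_intros)
    have xfi: "integrable (M n) (\<lambda>t. complex_of_real t * ?f t)" by (rule L2_integrable[OF xf])
    have eq: "(\<lambda>t. complex_of_real (g t) * ?f t)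
        = (\<lambda>t. of_real (real N + 1) * ?f t + of_real (- 2 * sqrt (real N)) * (complex_of_real t * ?f t))"
      by (auto simp: g algebra_simps)
    have four: "fourier (\<lambda>t. complex_of_real (g t) * ?f t) k
        = of_real (real N + 1) * fourier ?f k
          + of_real (- 2 * sqrt (real N)) * fourier (\<lambda>t. complex_of_real t * ?f t) k" for k
      unfolding eq by (rule fourier_lincomb[OF fi xfi])
    have "fourier (\<lambda>t. complex_of_real (g t) * ?f t) k = haar_coef N (tree_laplacian N v) (idx n k)" for k
    proof (cases k)
      case 0
      have i1: "idx n (Suc 0) = e n @ [Suc 0]" by (simp add: idx_def)
      have l: "fourier (\<lambda>t. complex_of_real (g t) * ?f t) 0
          = (real N + 1 - sqrt (real N) * A n) *\<^sub>R haar_coef N v (e n) - sqrt (real N) *\<^sub>R haar_coef N v (e n @ [Suc 0])"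
        unfolding four fourier_times_0[OF fi] fk using i1
        by (simp add: idx_def scaleR_conv_of_real algebra_simps)
      \<comment> \<open>At the root, \<open>sqrt N * A n = 1\<close> lowers the diagonal from
        \<open>N + 1\<close> to \<open>N\<close>. At any other head \<open>A n = 0\<close>, and the
        parent term vanishes because the last letter is not \<open>1\<close>.\<close>
      show ?thesis
      proof (cases "e n = []")
        case True
        have "sqrt (real N) * A n = 1" using True N by (simp add: A_def)
        then show ?thesis using l True haar_coef_laplacian_Nil[of N v] 0 by (simp add: idx_def)
      next
        case False
        then obtain u j where uj: "e n = u @ [j]" by (cases "e n" rule: rev_cases) auto
        then have "u \<in> tree_V N" "j \<in> {1..N}" "j \<noteq> 1"
          using en[OF n] by (auto simp: heads_def tree_V_def)
        then show ?thesis
          using l False haar_coef_laplacian_snoc[of u N j v] uj 0 by (simp add: idx_def A_def)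
      qed
    next
      case (Suc m)
      have idx_Suc: "idx n (Suc m) = idx n m @ [1]" for m
        by (simp add: idx_def replicate_append_same)
      then have i1: "idx n (Suc m) = idx n m @ [1]" "idx n (Suc (Suc m)) = idx n m @ [1] @ [Suc 0]"
        by simp_all
      have "fourier (\<lambda>t. complex_of_real (g t) * ?f t) k
          = (real N + 1) *\<^sub>R haar_coef N v (idx n (Suc m)) - sqrt (real N) *\<^sub>R haar_coef N v (idx n (Suc (Suc m)))
            - sqrt (real N) *\<^sub>R haar_coef N v (idx n m)"
        unfolding Suc four fourier_times_Suc[OF fi] fk
        by (simp add: scaleR_conv_of_real algebra_simps)
      also have "\<dots> = haar_coef N (tree_laplacian N v) (idx n (Suc m))"
        unfolding i1 using haar_coef_laplacian_snoc[OF idx_V[OF n, of m], of 1 v] N by simp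
      finally show ?thesis by (simp add: Suc)
    qed
    moreover have "(\<lambda>t. complex_of_real (g t) * ?f t) \<in> L2 (M n)"
      unfolding eq by (rule L2_lincomb[OF f xf])
    ultimately show ?thesis by (simp add: ok_def fc_def)
  qed
  show ?thesis
    unfolding lap_unitarily_equiv_mult_def
  proof (intro exI[of _ U] conjI ballI allI)
    fix v assume v: "v \<in> l2V N"
    show "U v \<in> dsum_space I M"
      unfolding dsum_space_def
    proof (intro CollectI conjI ballI allI impI)
      show "U v n \<in> L2 (M n)" if "n \<in> I" for n using ok_ex[OF v that] by (simp add: ok_def)
      show "U v n = (\<lambda>_. 0)" if "n \<notin> I" for n using that by (simp add: U_def)
      show "(\<lambda>n. L2_normsq (M n) (U v n)) summable_on I"
        using summable_on_Sigma_banach[OF S[OF v]] by (subst summable_on_cong[OF normU[OF v]]) auto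
    qed
    have "dsum_normsq I M (U v) = (\<Sum>\<^sub>\<infinity>n\<in>I. \<Sum>\<^sub>\<infinity>k\<in>UNIV. (cmod (haar_coef N v (idx n k)))\<^sup>2)"
      unfolding dsum_normsq_def by (intro infsum_cong normU[OF v])
    also have "\<dots> = (\<Sum>\<^sub>\<infinity>w\<in>tree_V N. (cmod (haar_coef N v w))\<^sup>2)"
      unfolding infsum_Sigma'_banach[OF S[OF v]] by (rule inf2)
    also have "\<dots> = l2V_normsq N v"
      using v by (intro haar_coef_normsq) (simp add: l2V_def)
    finally show "dsum_normsq I M (U v) = l2V_normsq N v" .
    show "dsum_eq I M (U (tree_laplacian N v)) (\<lambda>n t. complex_of_real (g t) * U v n t)"
      unfolding dsum_eq_def using U_eq mult[OF v] by blast
  next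
    fix v w a b assume "v \<in> l2V N" "w \<in> l2V N"
    then show "dsum_eq I M (U (\<lambda>x. a * v x + b * w x)) (\<lambda>n t. a * U v n t + b * U w n t)"
      unfolding dsum_eq_def using U_eq lin by blast
  next
    \<comment> \<open>Surjectivity: write the Fourier coefficients of \<open>F\<close> on the words
      of the chains and synthesise; the assumed summability of the norms places the result in
      \<open>l2V N\<close>.\<close>
    fix F assume F: "F \<in> dsum_space I M"
    have FL: "F n \<in> L2 (M n)" if "n \<in> I" for n using F that by (simp add: dsum_space_def)
    define inv where "inv = the_inv_into (I \<times> UNIV) (\<lambda>(n, k). idx n k)"
    define d where "d w = (case inv w of (n, k) \<Rightarrow> fc n (F n) k)" for w
    have d: "d (idx n k) = fc n (F n) k" if "n \<in> I" for n k
    proof -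
      have "inv (idx n k) = (n, k)"
        using the_inv_into_f_f[of "\<lambda>(n, k). idx n k" "I \<times> UNIV" "(n, k)"] bij that
        by (simp add: inv_def bij_betw_def)
      then show ?thesis by (simp add: d_def)
    qed
    define v where "v = haar_synth N d"
    have cv: "haar_coef N v (idx n k) = fc n (F n) k" if "n \<in> I" for n k
      unfolding v_def using haar_coef_haar_synth[OF idx_V[OF that]] d[OF that] by simp
    have "(\<lambda>(n, k). (cmod (haar_coef N v (idx n k)))\<^sup>2) summable_on I \<times> UNIV"
    proof (rule summable_on_SigmaI)
      show "((\<lambda>k. case (n, k) of (n, k) \<Rightarrow> (cmod (haar_coef N v (idx n k)))\<^sup>2) has_sum L2_normsq (M n) (F n)) UNIV"
        if "n \<in> I" for n
        using pars[OF that FL[OF that]] cv[OF that] by simp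
      show "(\<lambda>n. L2_normsq (M n) (F n)) summable_on I" using F by (simp add: dsum_space_def)
    qed auto
    then have "v \<in> l2V N"
      unfolding sum2 haar_coef_summable_iff by (simp add: l2V_def v_def haar_synth_def)
    moreover have "ok v n (F n)" if "n \<in> I" for n
      using FL[OF that] cv[OF that] by (simp add: ok_def)
    then have "dsum_eq I M (U v) F"
      unfolding dsum_eq_def using U_eq by blast
    ultimately show "\<exists>v\<in>l2V N. dsum_eq I M (U v) F" by blast
  qed
qed

lemma heads_1: "heads (Suc 0) = {[]}"
proof -
  have "w = []" if "w \<in> heads (Suc 0)" for w
    using that by (cases w rule: rev_cases) (auto simp: heads_def tree_V_def)
  then show ?thesis by (auto simp: heads_def tree_V_def)
qed

lemma heads_enumeration:
  assumes N: "N \<ge> 2"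
  obtains e :: "nat \<Rightarrow> nat list" where "bij_betw e UNIV (heads N)" "e 0 = []"
proof -
  \<comment> \<open>The words \<open>1...12\<close> are infinitely many nonempty heads; a second
    letter requires \<open>N \<ge> 2\<close>.\<close>
  have "inj (\<lambda>n. replicate n (1::nat) @ [2])"
    by (rule injI) (metis append_same_eq length_replicate)
  moreover have "range (\<lambda>n. replicate n (1::nat) @ [2]) \<subseteq> heads N - {[]}"
    using N by (auto simp: heads_def tree_V_def)
  ultimately have "infinite (heads N - {[]})"
    using infinite_iff_countable_subset by blast
  then obtain h :: "nat list \<Rightarrow> nat" where h: "bij_betw h (heads N - {[]}) UNIV"
    using countableE_infinite[of "heads N - {[]}"] by (metis countableI_type)
  \<comment> \<open>Index \<open>0\<close> is reserved for the root, whose chain carries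
    \<open>mu_cp\<close>.\<close>
  define e where "e n = (case n of 0 \<Rightarrow> [] | Suc m \<Rightarrow> the_inv_into (heads N - {[]}) h m)" for n
  have h': "bij_betw (the_inv_into (heads N - {[]}) h) UNIV (heads N - {[]})"
    by (rule bij_betw_the_inv_into[OF h])
  have nil: "[] \<in> heads N" by (simp add: heads_def tree_V_def)
  have "bij_betw e UNIV (heads N)"
  proof (rule bij_betw_imageI)
    show "inj e"
    proof (rule injI)
      fix m n assume "e m = e n"
      moreover have ne: "the_inv_into (heads N - {[]}) h k \<noteq> []" for k
        using h' by (auto simp: bij_betw_def)
      ultimately show "m = n"
        using bij_betw_imp_inj_on[OF h'] ne[symmetric] by (auto simp: e_def inj_def split: nat.splits)
    qed
    have "range e = insert (e 0) (range (\<lambda>m. e (Suc m)))"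
      by (metis UNIV_nat_eq image_insert image_image)
    also have "\<dots> = heads N"
      using h' nil by (auto simp: e_def bij_betw_def)
    finally show "range e = heads N" .
  qed
  then show ?thesis by (rule that) (simp add: e_def)
qed

theorem theorem3p26:
  fixes N :: nat
  assumes "N \<ge> 1"
  shows "(N = 1 \<longrightarrow>
           lap_unitarily_equiv_mult N {0} (\<lambda>_. mu_cp N) (\<lambda>x. 2 - 2 * x))
       \<and> (N \<ge> 2 \<longrightarrow>
           lap_unitarily_equiv_mult N UNIV
             (\<lambda>n. if n = 0 then mu_cp N else mu_c)
             (\<lambda>x. real N + 1 - 2 * sqrt (real N) * x))"
proof (intro conjI impI)
  \<comment> \<open>With one letter the tree is a half-line, all of which is the radial chain; the
    multiplier \<open>N + 1 - 2 * sqrt N * x\<close> becomes \<open>2 - 2 * x\<close>.\<close>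
  assume "N = 1"
  then show "lap_unitarily_equiv_mult N {0} (\<lambda>_. mu_cp N) (\<lambda>x. 2 - 2 * x)"
    using jacobi_measure_mu_cp[OF assms]
    by (intro laplacian_equiv_jacobi[of N "\<lambda>_. []"]) (auto simp: heads_1 bij_betw_def)
next
  assume N: "N \<ge> 2"
  obtain e :: "nat \<Rightarrow> nat list" where e: "bij_betw e UNIV (heads N)" "e 0 = []"
    by (rule heads_enumeration[OF N])
  have "e n = [] \<longleftrightarrow> n = 0" for n
    using inj_eq[OF bij_betw_imp_inj_on[OF e(1)], of n 0] e(2) by simp
  then show "lap_unitarily_equiv_mult N UNIV (\<lambda>n. if n = 0 then mu_cp N else mu_c)
      (\<lambda>x. real N + 1 - 2 * sqrt (real N) * x)"
    using jacobi_measure_mu_cp[OF assms] jacobi_measure_mu_c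
    by (intro laplacian_equiv_jacobi[OF assms e(1)]) auto
qed

end
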